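(* Let $I\subset\mathbb{N}$ be an infinite set of positive integers, and let $h$ be the Hausdorff dimension of $J_I$. Assume that the $h$-dimensional Hausdorff measure $\mathcal{H}^h$ restricted to $J_I$ is Ahlfors $h$-regular. Let $\mu=\mathcal{H}^h|_{J_I}$, and let $\psi:\mathbb{N}\to(0,+\infty)$ be a function such that $q\mapsto q^2\psi(q)$ is nonincreasing. If the series $$\sum_{q=1}^\infty q^{2h-1}\psi(q)^h$$ diverges, then $\mu$-almost every point is $\psi$-approximable; if the series converges, then $\mu$-almost no point is $\psi$-approximable.
   Context: For a set $I$ of positive integers, $J_I$ is the set of irrational $x\in[0,1]$ all of whose continued fraction entries (in $x=[0;\omega_0,\omega_1,\ldots]$) lie in $I$. For $\delta>0$, a (nonzero, Borel, locally finite) measure $\mu$ on $\mathbb{R}$ is Ahlfors $\delta$-regular if there exist constants $C_1,C_2>0$ such that $C_1r^\delta\le\mu(B(x,r))\le C_2r^\delta$ for all $x$ in the topological support of $\mu$ and all $0<r\le 1$. An irrational $x$ is $\psi$-approximable if there exist infinitely many rationals $p/q$ (in lowest terms, $q\ge1$) with $|x-p/q|\le\psi(q)$. "$\mu$-almost no point" means that the set of such points is $\mu$-null. *)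

theory Defs
  imports "HOL-Analysis.Analysis"
begin

section \<open>Hausdorff measure and Hausdorff dimension\<close>

text \<open>
  The \<open>s\<close>-th power of the diameter.  The case \<open>s = 0\<close> is separate because
  \<open>0 powr 0 = 0\<close> in the library, whereas \<open>0\<close>-dimensional Hausdorff measure has to
  count points.
\<close>
definition diam_pow :: "real \<Rightarrow> 'a::metric_space set \<Rightarrow> ennreal" where
  "diam_pow s U = (if U = {} then 0 else if s = 0 then 1 else ennreal (diameter U powr s))"

text \<open>Boundedness is required because \<^term>\<open>diameter\<close> is a real number, meaningful on bounded sets only.\<close>
definition small_covers :: "real \<Rightarrow> 'a::metric_space set \<Rightarrow> (nat \<Rightarrow> 'a set) set" where
  "small_covers \<delta> A = {U. A \<subseteq> (\<Union>i. U i) \<and> (\<forall>i. bounded (U i) \<and> diameter (U i) \<le> \<delta>)}"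

definition hausdorff_content :: "real \<Rightarrow> real \<Rightarrow> 'a::metric_space set \<Rightarrow> ennreal" where
  "hausdorff_content s \<delta> A = (INF U\<in>small_covers \<delta> A. \<Sum>i. diam_pow s (U i))"

definition hausdorff_outer :: "real \<Rightarrow> 'a::metric_space set \<Rightarrow> ennreal" where
  "hausdorff_outer s A = (SUP \<delta>\<in>{0<..}. hausdorff_content s \<delta> A)"

text \<open>
  The restriction to \<open>E\<close> of \<open>s\<close>-dimensional Hausdorff measure, as a Borel measure on the whole
  space.  Lemma \<open>emeasure_hausdorff_on\<close> below shows that it has the intended values on Borel sets.
\<close>
definition hausdorff_on :: "real \<Rightarrow> 'a::metric_space set \<Rightarrow> 'a measure" where
  "hausdorff_on s E = measure_of UNIV (sets borel) (\<lambda>A. hausdorff_outer s (A \<inter> E))"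

text \<open>
  The infimum is over a nonempty set for every set of real numbers; for subsets of the unit
  interval see lemma \<open>hausdorff_outer_unit_interval\<close> below.
\<close>
definition hausdorff_dim :: "real set \<Rightarrow> real" where
  "hausdorff_dim A = Inf {s. 0 \<le> s \<and> hausdorff_outer s A = 0}"


section \<open>Continued fractions\<close>

text \<open>\<open>cf_conv \<omega> n\<close> is the finite continued fraction \<open>[0; \<omega> 0, \<dots>, \<omega> (n - 1)]\<close>.\<close>
primrec cf_conv :: "(nat \<Rightarrow> nat) \<Rightarrow> nat \<Rightarrow> real" where
  "cf_conv \<omega> 0 = 0"
| "cf_conv \<omega> (Suc n) = 1 / (real (\<omega> 0) + cf_conv (\<lambda>i. \<omega> (Suc i)) n)"

text \<open>\<open>x = [0; \<omega> 0, \<omega> 1, \<dots>]\<close>\<close>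
definition cf_expansion :: "real \<Rightarrow> (nat \<Rightarrow> nat) \<Rightarrow> bool" where
  "cf_expansion x \<omega> \<longleftrightarrow> (\<forall>i. 1 \<le> \<omega> i) \<and> cf_conv \<omega> \<longlonglongrightarrow> x"

text \<open>The expansion of an irrational number is unique, so \<open>\<omega>\<close> below is the sequence of its entries.\<close>
definition cf_set :: "nat set \<Rightarrow> real set" where
  "cf_set I = {x \<in> {0..1} - \<rat>. \<exists>\<omega>. cf_expansion x \<omega> \<and> (\<forall>i. \<omega> i \<in> I)}"


section \<open>Ahlfors regularity and approximability\<close>

definition measure_support :: "'a::topological_space measure \<Rightarrow> 'a set" where
  "measure_support M = {x. \<forall>U. open U \<and> x \<in> U \<longrightarrow> emeasure M U > 0}"

definition locally_finite_measure :: "'a::topological_space measure \<Rightarrow> bool" where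
  "locally_finite_measure M \<longleftrightarrow> (\<forall>x. \<exists>U. open U \<and> x \<in> U \<and> emeasure M U < \<infinity>)"

definition ahlfors_regular :: "real \<Rightarrow> real measure \<Rightarrow> bool" where
  "ahlfors_regular \<delta> M \<longleftrightarrow>
     0 < \<delta> \<and> sets M = sets borel \<and> emeasure M UNIV \<noteq> 0 \<and> locally_finite_measure M \<and>
     (\<exists>C1>0. \<exists>C2>0. \<forall>x\<in>measure_support M. \<forall>r. 0 < r \<and> r \<le> 1 \<longrightarrow>
        ennreal (C1 * r powr \<delta>) \<le> emeasure M (ball x r) \<and>
        emeasure M (ball x r) \<le> ennreal (C2 * r powr \<delta>))"

definition psi_approximable :: "(nat \<Rightarrow> real) \<Rightarrow> real \<Rightarrow> bool" where
  "psi_approximable \<psi> x \<longleftrightarrow> x \<notin> \<rat> \<and>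
     infinite {(p::int, q::nat). 1 \<le> q \<and> coprime p (int q) \<and> \<bar>x - of_int p / of_nat q\<bar> \<le> \<psi> q}"


section \<open>Basic facts on Hausdorff measure\<close>

lemma diam_pow_empty [simp]: "diam_pow s {} = 0"
  by (simp add: diam_pow_def)

lemma hausdorff_content_le:
  "U \<in> small_covers \<delta> A \<Longrightarrow> hausdorff_content s \<delta> A \<le> (\<Sum>i. diam_pow s (U i))"
  unfolding hausdorff_content_def by (rule INF_lower)

lemma small_covers_mono: "A \<subseteq> B \<Longrightarrow> \<delta> \<le> \<epsilon> \<Longrightarrow> small_covers \<delta> B \<subseteq> small_covers \<epsilon> A"
  unfolding small_covers_def by (auto intro: order_trans)

lemma hausdorff_content_mono:
  "A \<subseteq> B \<Longrightarrow> \<delta> \<le> \<epsilon> \<Longrightarrow> hausdorff_content s \<epsilon> A \<le> hausdorff_content s \<delta> B"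
  unfolding hausdorff_content_def by (rule INF_superset_mono[OF small_covers_mono]) auto

lemma hausdorff_content_le_outer: "0 < \<delta> \<Longrightarrow> hausdorff_content s \<delta> A \<le> hausdorff_outer s A"
  unfolding hausdorff_outer_def by (rule SUP_upper) simp

lemma hausdorff_outer_mono: "A \<subseteq> B \<Longrightarrow> hausdorff_outer s A \<le> hausdorff_outer s B"
  unfolding hausdorff_outer_def
  by (rule SUP_mono') (simp add: hausdorff_content_mono)

lemma hausdorff_outer_empty [simp]: "hausdorff_outer s {} = 0"
proof -
  have "hausdorff_content s \<delta> ({}::'a set) \<le> 0" if "0 < \<delta>" for \<delta>
    using hausdorff_content_le[of "\<lambda>_. {}" \<delta> "{}" s] that by (simp add: small_covers_def)
  then have "hausdorff_outer s ({}::'a set) \<le> 0"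
    unfolding hausdorff_outer_def by (intro SUP_least) auto
  then show ?thesis by simp
qed

lemma hausdorff_content_subadditive:
  "hausdorff_content s \<delta> (\<Union>i. A i) \<le> (\<Sum>n. hausdorff_content s \<delta> (A n))"
proof (rule ennreal_le_epsilon)
  fix e :: real
  assume e: "0 < e" and fin: "(\<Sum>n. hausdorff_content s \<delta> (A n)) < top"
  have *: "hausdorff_content s \<delta> (A n) < hausdorff_content s \<delta> (A n) + e * (1/2)^Suc n" for n
    using fin e by (auto simp add: less_top dest!: ennreal_suminf_lessD)
  have "\<exists>U. U \<in> small_covers \<delta> (A n) \<and>
          (\<Sum>i. diam_pow s (U i)) < hausdorff_content s \<delta> (A n) + e * (1/2)^Suc n" for n
    using *[of n] unfolding hausdorff_content_def[of s \<delta> "A n"] INF_less_iff by blast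
  then obtain B where B: "\<And>n. B n \<in> small_covers \<delta> (A n)"
    and Ble: "\<And>n. (\<Sum>i. diam_pow s (B n i)) < hausdorff_content s \<delta> (A n) + e * (1/2)^Suc n"
    by metis
  define C where "C = case_prod B o prod_decode"
  have "(\<Union>i. A i) \<subseteq> (\<Union>i. C i)"
  proof
    fix x assume "x \<in> (\<Union>i. A i)"
    then obtain n j where "x \<in> B n j"
      using B unfolding small_covers_def by blast
    then have "x \<in> C (prod_encode (n, j))"
      by (simp add: C_def)
    then show "x \<in> (\<Union>i. C i)" by blast
  qed
  moreover have "bounded (C i) \<and> diameter (C i) \<le> \<delta>" for i
    using B unfolding small_covers_def C_def by (simp add: split_def)
  ultimately have "C \<in> small_covers \<delta> (\<Union>i. A i)"
    by (simp add: small_covers_def)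
  then have "hausdorff_content s \<delta> (\<Union>i. A i) \<le> (\<Sum>i. diam_pow s (C i))"
    by (rule hausdorff_content_le)
  also have "\<dots> = (\<Sum>i. (\<lambda>(n, j). diam_pow s (B n j)) (prod_decode i))"
    by (simp add: C_def split_def)
  also have "\<dots> = (\<Sum>n. \<Sum>i. diam_pow s (B n i))"
    using suminf_ennreal_2dimen[of "\<lambda>n. \<Sum>i. diam_pow s (B n i)" "\<lambda>(n, j). diam_pow s (B n j)"]
    by (simp add: comp_def)
  also have "\<dots> \<le> (\<Sum>n. hausdorff_content s \<delta> (A n) + e * (1/2) ^ Suc n)"
    by (intro suminf_le less_imp_le[OF Ble] allI) auto
  also have "... = (\<Sum>n. hausdorff_content s \<delta> (A n)) + (\<Sum>n. ennreal e * ennreal ((1/2) ^ Suc n))"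
    using e by (subst suminf_add[symmetric])
               (auto simp del: ennreal_suminf_cmult simp add: ennreal_mult[symmetric])
  also have "\<dots> = (\<Sum>n. hausdorff_content s \<delta> (A n)) + e"
    unfolding ennreal_suminf_cmult
    by (subst suminf_ennreal_eq[OF zero_le_power power_half_series]) auto
  finally show "hausdorff_content s \<delta> (\<Union>i. A i) \<le> (\<Sum>n. hausdorff_content s \<delta> (A n)) + e" .
qed

lemma hausdorff_outer_subadditive:
  "hausdorff_outer s (\<Union>i. A i) \<le> (\<Sum>n. hausdorff_outer s (A n))"
proof -
  have "hausdorff_content s \<delta> (\<Union>i. A i) \<le> (\<Sum>n. hausdorff_outer s (A n))" if "0 < \<delta>" for \<delta>
    using hausdorff_content_subadditive
    by (rule order_trans) (intro suminf_le hausdorff_content_le_outer[OF that] allI; simp)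
  then show ?thesis
    unfolding hausdorff_outer_def[of s "\<Union>i. A i"] by (intro SUP_least) auto
qed

lemma hausdorff_content_separated:
  assumes sep: "\<And>x y. x \<in> A \<Longrightarrow> y \<in> B \<Longrightarrow> d \<le> dist x y" and \<delta>: "0 < \<delta>" "\<delta> < d"
  shows "hausdorff_content s \<delta> A + hausdorff_content s \<delta> B \<le> hausdorff_content s \<delta> (A \<union> B)"
  unfolding hausdorff_content_def[of s \<delta> "A \<union> B"]
proof (rule INF_greatest)
  fix U assume U: "U \<in> small_covers \<delta> (A \<union> B)"
  define V where "V = (\<lambda>i. if U i \<inter> A = {} then {} else U i)"
  define W where "W = (\<lambda>i. if U i \<inter> B = {} then {} else U i)"
  have "V \<in> small_covers \<delta> A" "W \<in> small_covers \<delta> B"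
    using U \<delta> unfolding small_covers_def V_def W_def by fastforce+
  then have "hausdorff_content s \<delta> A + hausdorff_content s \<delta> B
      \<le> (\<Sum>i. diam_pow s (V i)) + (\<Sum>i. diam_pow s (W i))"
    by (intro add_mono hausdorff_content_le)
  also have "\<dots> = (\<Sum>i. diam_pow s (V i) + diam_pow s (W i))"
    by (rule suminf_add) auto
  also have "\<dots> \<le> (\<Sum>i. diam_pow s (U i))"
  proof (intro suminf_le allI)
    fix i
    have "U i \<inter> A = {} \<or> U i \<inter> B = {}"
    proof (rule ccontr)
      assume "\<not> ?thesis"
      then obtain x y where xy: "x \<in> U i" "x \<in> A" "y \<in> U i" "y \<in> B" by blast
      have "dist x y \<le> diameter (U i)"
        using U xy by (intro diameter_bounded_bound) (auto simp: small_covers_def)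
      also have "\<dots> \<le> \<delta>" using U by (auto simp: small_covers_def)
      finally show False using sep[of x y] xy \<delta> by simp
    qed
    then show "diam_pow s (V i) + diam_pow s (W i) \<le> diam_pow s (U i)"
      by (auto simp: V_def W_def)
  qed auto
  finally show "hausdorff_content s \<delta> A + hausdorff_content s \<delta> B \<le> (\<Sum>i. diam_pow s (U i))" .
qed

lemma hausdorff_outer_separated:
  assumes sep: "\<And>x y. x \<in> A \<Longrightarrow> y \<in> B \<Longrightarrow> d \<le> dist x y" and d: "0 < d"
  shows "hausdorff_outer s A + hausdorff_outer s B \<le> hausdorff_outer s (A \<union> B)"
proof -
  have *: "hausdorff_content s \<delta> A + hausdorff_content s \<epsilon> B \<le> hausdorff_outer s (A \<union> B)"
    if "0 < \<delta>" "0 < \<epsilon>" for \<delta> \<epsilon>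
  proof -
    define \<eta> where "\<eta> = min (min \<delta> \<epsilon>) (d / 2)"
    have \<eta>: "0 < \<eta>" "\<eta> < d" "\<eta> \<le> \<delta>" "\<eta> \<le> \<epsilon>"
      using that d by (auto simp: \<eta>_def)
    have "hausdorff_content s \<delta> A + hausdorff_content s \<epsilon> B
        \<le> hausdorff_content s \<eta> A + hausdorff_content s \<eta> B"
      using \<eta> by (intro add_mono hausdorff_content_mono) auto
    also have "\<dots> \<le> hausdorff_content s \<eta> (A \<union> B)"
      using hausdorff_content_separated[OF sep \<eta>(1,2)] by simp
    also have "\<dots> \<le> hausdorff_outer s (A \<union> B)"
      by (rule hausdorff_content_le_outer[OF \<eta>(1)])
    finally show ?thesis .
  qed
  have ne: "{0::real<..} \<noteq> {}" by simp
  have "hausdorff_outer s A + hausdorff_content s \<epsilon> B \<le> hausdorff_outer s (A \<union> B)"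
    if "0 < \<epsilon>" for \<epsilon>
    unfolding hausdorff_outer_def[of s A] ennreal_SUP_add_left[OF ne, symmetric]
    using * that by (intro SUP_least) auto
  then show ?thesis
    unfolding hausdorff_outer_def[of s B] ennreal_SUP_add_right[OF ne]
    by (intro SUP_least) auto
qed

text \<open>Caratheodory's criterion: Borel sets are measurable for a metric outer measure.\<close>

lemma metric_outer_measure_closed:
  fixes f :: "'a::metric_space set \<Rightarrow> ennreal"
  assumes f0: "f {} = 0" and mono: "\<And>A B. A \<subseteq> B \<Longrightarrow> f A \<le> f B"
    and sub: "\<And>A::nat \<Rightarrow> 'a set. f (\<Union>i. A i) \<le> (\<Sum>i. f (A i))"
    and sep: "\<And>A B d. 0 < d \<Longrightarrow> (\<And>x y. x \<in> A \<Longrightarrow> y \<in> B \<Longrightarrow> d \<le> dist x y)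
                 \<Longrightarrow> f A + f B \<le> f (A \<union> B)"
    and F: "closed F"
  shows "f (X \<inter> F) + f (X - F) \<le> f X"
proof (cases "f X = top \<or> F = {}")
  case True
  then show ?thesis using f0 by auto
next
  case False
  then have fin: "f X < top" and Fne: "F \<noteq> {}" by (auto simp: less_top)
  have sub2: "f (A \<union> B) \<le> f A + f B" for A B
  proof -
    have "f (A \<union> B) \<le> (\<Sum>i. f (binaryset A B i))"
      using sub[of "binaryset A B"] by (simp add: UN_binaryset_eq)
    also have "\<dots> = f A + f B"
      by (rule suminf_binaryset_eq) (simp add: f0)
    finally show ?thesis .
  qed
  define B where "B n = {x \<in> X. 1 / real (Suc n) \<le> infdist x F}" for n
  define R where "R k = {x \<in> X. 1 / real (Suc (Suc k)) \<le> infdist x F \<and> infdist x F < 1 / real (Suc k)}"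
    for k
  have lip: "infdist x F - infdist y F \<le> dist x y" for x y
    using infdist_triangle[of x F y] by simp
  have BF: "f (X \<inter> F) + f (B n) \<le> f X" for n
  proof -
    have "f (X \<inter> F) + f (B n) \<le> f (X \<inter> F \<union> B n)"
    proof (rule sep)
      show "0 < 1 / real (Suc n)" by simp
      fix x y assume "x \<in> X \<inter> F" "y \<in> B n"
      then show "1 / real (Suc n) \<le> dist x y"
        using lip[of y x] by (simp add: B_def dist_commute)
    qed
    also have "\<dots> \<le> f X" by (rule mono) (auto simp: B_def)
    finally show ?thesis .
  qed
  have part: "(\<Sum>k<n. f (R (2 * k + c))) \<le> f (\<Union>k<n. R (2 * k + c))" for n c
  proof (induction n)
    case 0
    then show ?case by simp
  next
    case (Suc n)
    let ?a = "1 / real (2 * n + c + 1)"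
    let ?b = "1 / real (2 * n + c)"
    have "f (\<Union>k<n. R (2 * k + c)) + f (R (2 * n + c)) \<le> f ((\<Union>k<n. R (2 * k + c)) \<union> R (2 * n + c))"
    proof (cases "n = 0")
      case True
      then show ?thesis by (simp add: f0)
    next
      case n: False
      show ?thesis
      proof (rule sep)
        have "?a < ?b" using n by (intro frac_less2) auto
        then show "0 < ?b - ?a" by simp
        fix x y assume "x \<in> (\<Union>k<n. R (2 * k + c))" and y: "y \<in> R (2 * n + c)"
        then obtain k where k: "k < n" "x \<in> R (2 * k + c)" by blast
        have "?b \<le> 1 / real (Suc (Suc (2 * k + c)))"
          using k n by (intro divide_left_mono) auto
        also have "\<dots> \<le> infdist x F" using k by (simp add: R_def)
        finally have "?b \<le> infdist x F" .
        moreover have "infdist y F < ?a" using y by (simp add: R_def add.commute)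
        ultimately show "?b - ?a \<le> dist x y" using lip[of x y] by linarith
      qed
    qed
    moreover have "(\<Union>k<Suc n. R (2 * k + c)) = (\<Union>k<n. R (2 * k + c)) \<union> R (2 * n + c)"
      by (auto simp: lessThan_Suc)
    moreover have "(\<Sum>k<Suc n. f (R (2 * k + c))) \<le> f (\<Union>k<n. R (2 * k + c)) + f (R (2 * n + c))"
      using Suc.IH by (simp add: add_right_mono)
    ultimately show ?case by (simp only: order_trans)
  qed
  have part': "(\<Sum>k<n. f (R (2 * k + c))) \<le> f X" for n c
    by (rule order_trans[OF part mono]) (auto simp: R_def)
  have "(\<Sum>k<n. f (R k)) \<le> f X + f X" for n
  proof -
    have "(\<Sum>k<n. f (R k)) \<le> (\<Sum>k<2*n. f (R k))"
      by (rule sum_mono2) auto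
    also have "\<dots> = (\<Sum>k<n. f (R (2 * k + 0))) + (\<Sum>k<n. f (R (2 * k + 1)))"
      by (induction n) (auto simp: algebra_simps)
    also have "\<dots> \<le> f X + f X" by (intro add_mono part')
    finally show ?thesis .
  qed
  then have "(\<Sum>k. f (R k)) \<le> f X + f X"
    by (intro suminf_le_const) auto
  then have sfin: "(\<Sum>k. f (R k)) \<noteq> top"
    using fin by (metis ennreal_add_eq_top less_top top.extremum_uniqueI)
  define r where "r k = enn2real (f (R k))" for k
  have Rk: "f (R k) = ennreal (r k)" for k
  proof -
    have "f (R k) \<le> f X" by (rule mono) (auto simp: R_def)
    then show ?thesis using fin unfolding r_def by (simp add: le_less_trans)
  qed
  have r0: "0 \<le> r k" for k by (simp add: r_def)
  have sr: "summable r"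
    using sfin r0 by (intro summable_suminf_not_top) (simp_all add: Rk)
  show ?thesis
  proof (rule ennreal_le_epsilon)
    fix e :: real assume "0 < e"
    then obtain n where "norm (\<Sum>i. r (i + n)) < e"
      using suminf_exist_split[OF _ sr] by blast
    then have "(\<Sum>i. f (R (i + n))) \<le> ennreal e"
      using sr r0 unfolding Rk
      by (subst suminf_ennreal2) (auto simp: summable_iff_shift intro!: ennreal_leI)
    moreover have "X - F \<subseteq> B n \<union> (\<Union>i. R (i + n))"
    proof
      fix x assume x: "x \<in> X - F"
      have pos: "0 < infdist x F"
        using x F Fne in_closed_iff_infdist_zero[of F x] infdist_nonneg[of x F] by fastforce
      show "x \<in> B n \<union> (\<Union>i. R (i + n))"
      proof (cases "1 / real (Suc n) \<le> infdist x F")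
        case True
        then show ?thesis using x by (simp add: B_def)
      next
        case far: False
        define P where "P m \<longleftrightarrow> 1 / real (Suc m) \<le> infdist x F" for m
        have "\<exists>m. P m"
          using nat_approx_posE[OF pos] unfolding P_def by (metis less_imp_le of_nat_Suc)
        then have P: "P (LEAST m. P m)" by (rule LeastI_ex)
        have "n < (LEAST m. P m)"
        proof (rule ccontr)
          assume "\<not> n < (LEAST m. P m)"
          then have "1 / real (Suc n) \<le> 1 / real (Suc (LEAST m. P m))"
            by (intro divide_left_mono) auto
          then show False using P far unfolding P_def by linarith
        qed
        then obtain j where j: "(LEAST m. P m) = Suc (j + n)"
          by (metis less_iff_Suc_add add.commute)
        have "\<not> P (j + n)" using j not_less_Least[of "j + n" P] by simp
        then have "x \<in> R (j + n)" using P x unfolding j by (simp add: P_def R_def)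
        then show ?thesis by blast
      qed
    qed
    then have "f (X - F) \<le> f (B n \<union> (\<Union>i. R (i + n)))"
      by (rule mono)
    then have "f (X - F) \<le> f (B n) + (\<Sum>i. f (R (i + n)))"
      by (rule order_trans[OF order_trans[OF _ sub2] add_left_mono[OF sub]])
    ultimately have "f (X - F) \<le> f (B n) + e"
      using order_trans[OF _ add_left_mono] by blast
    then have "f (X \<inter> F) + f (X - F) \<le> f (X \<inter> F) + f (B n) + e"
      by (simp add: add.assoc add_left_mono)
    also have "\<dots> \<le> f X + e" using BF by (rule add_right_mono)
    finally show "f (X \<inter> F) + f (X - F) \<le> f X + e" .
  qed
qed

lemma hausdorff_on_measure_space:
  fixes E :: "'a::metric_space set"
  shows "measure_space UNIV (sets borel) (\<lambda>A. hausdorff_outer s (A \<inter> E))"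
proof -
  let ?f = "\<lambda>A. hausdorff_outer s (A \<inter> E)"
  let ?L = "lambda_system UNIV (Pow UNIV) ?f"
  interpret P: sigma_algebra UNIV "Pow UNIV :: 'a set set" by (rule sigma_algebra_Pow)
  have mono: "?f A \<le> ?f B" if "A \<subseteq> B" for A B
    using that by (intro hausdorff_outer_mono) auto
  have sub: "?f (\<Union>i. A i) \<le> (\<Sum>i. ?f (A i))" for A :: "nat \<Rightarrow> 'a set"
    using hausdorff_outer_subadditive[of s "\<lambda>i. A i \<inter> E"] by simp
  have sep: "?f A + ?f B \<le> ?f (A \<union> B)"
    if "0 < d" "\<And>x y. x \<in> A \<Longrightarrow> y \<in> B \<Longrightarrow> d \<le> dist x y" for A B d
    using hausdorff_outer_separated[of "A \<inter> E" "B \<inter> E" d s] that by (simp add: Int_Un_distrib2)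
  have "outer_measure_space (Pow UNIV) ?f"
    unfolding outer_measure_space_def positive_def increasing_def countably_subadditive_def
    using mono sub by auto
  from P.caratheodory_lemma[OF this] have L: "measure_space UNIV ?L ?f" .
  then interpret L: sigma_algebra UNIV ?L by (simp add: measure_space_def)
  have closed_in: "F \<in> ?L" if "closed F" for F
  proof -
    have "?f (X \<inter> F) + ?f (X - F) = ?f X" for X
    proof (rule antisym)
      show "?f (X \<inter> F) + ?f (X - F) \<le> ?f X"
        by (rule metric_outer_measure_closed[where f = ?f, OF _ mono sub sep that]) auto
      have "?f ((X \<inter> F) \<union> (X - F)) \<le> (\<Sum>i. ?f (binaryset (X \<inter> F) (X - F) i))"
        using sub[of "binaryset (X \<inter> F) (X - F)"] by (simp add: UN_binaryset_eq)
      also have "\<dots> = ?f (X \<inter> F) + ?f (X - F)"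
        by (rule suminf_binaryset_eq) simp
      finally show "?f X \<le> ?f (X \<inter> F) + ?f (X - F)"
        by (simp add: Int_Diff_Un)
    qed
    then show ?thesis unfolding P.lambda_system_eq by blast
  qed
  have "sigma_sets UNIV (Collect closed) \<subseteq> ?L"
    using closed_in by (intro L.sigma_sets_subset) blast
  then have "sets borel \<subseteq> ?L"
    unfolding borel_eq_closed by (subst sets_measure_of) auto
  moreover have "sigma_algebra UNIV (sets (borel :: 'a measure))"
    using sets.sigma_algebra_axioms[of "borel :: 'a measure"] by simp
  ultimately show ?thesis
    using L unfolding measure_space_def positive_def countably_additive_def by blast
qed

lemma sets_hausdorff_on [simp]:
  fixes E :: "'a::metric_space set"
  shows "sets (hausdorff_on s E) = sets borel"
  using sets.sets_measure_of_eq[of "borel :: 'a measure"] unfolding hausdorff_on_def by simp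

lemma space_hausdorff_on [simp]: "space (hausdorff_on s E) = UNIV"
  using sets_eq_imp_space_eq[OF sets_hausdorff_on] by simp

lemma emeasure_hausdorff_on:
  assumes "A \<in> sets borel"
  shows "emeasure (hausdorff_on s E) A = hausdorff_outer s (A \<inter> E)"
  unfolding hausdorff_on_def
  using hausdorff_on_measure_space[of s E] assms
  by (intro emeasure_measure_of_sigma) (auto simp: measure_space_def)

lemma hausdorff_outer_unit_interval:
  assumes A: "A \<subseteq> {0..1::real}" and s: "1 < s"
  shows "hausdorff_outer s A = 0"
proof -
  have "hausdorff_content s \<delta> A \<le> 0" if \<delta>: "0 < \<delta>" for \<delta>
  proof -
    define U where "U n i = (if i < Suc n then {real i / real (Suc n) .. real (Suc i) / real (Suc n)} else {})"
      for n i
    have bound: "hausdorff_content s \<delta> A \<le> ennreal (real (Suc n) powr (1 - s))"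
      if n: "1 / real (Suc n) \<le> \<delta>" for n
    proof -
      have diam: "diameter (U n i) = 1 / real (Suc n)" if "i < Suc n" for i
        using that by (simp add: U_def field_simps diameter_closed_interval)
      have "x \<in> (\<Union>i. U n i)" if x: "x \<in> {0..1}" for x
      proof (cases "x = 1")
        case True
        then have "x \<in> U n n" by (simp add: U_def)
        then show ?thesis by blast
      next
        case False
        define i where "i = nat \<lfloor>x * real (Suc n)\<rfloor>"
        have "real i \<le> x * real (Suc n)" "x * real (Suc n) \<le> real (Suc i)"
          using x unfolding i_def by (auto simp del: of_nat_Suc) (simp, linarith)
        moreover have "x * real (Suc n) < real (Suc n)" using x False by simp
        ultimately have i: "i < Suc n" "real i \<le> x * real (Suc n)" "x * real (Suc n) \<le> real (Suc i)"
          by (linarith | simp)+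
        then have "x \<in> U n i"
          by (simp add: U_def pos_divide_le_eq pos_le_divide_eq del: of_nat_Suc)
        then show ?thesis by blast
      qed
      then have "U n \<in> small_covers \<delta> A"
        using A n diam \<delta> unfolding small_covers_def
        by (auto simp: U_def)
      then have "hausdorff_content s \<delta> A \<le> (\<Sum>i. diam_pow s (U n i))"
        by (rule hausdorff_content_le)
      also have "\<dots> = (\<Sum>i<Suc n. diam_pow s (U n i))"
        by (rule suminf_finite) (auto simp: U_def)
      also have "\<dots> = (\<Sum>i<Suc n. ennreal ((1 / real (Suc n)) powr s))"
      proof (rule sum.cong)
        fix i assume "i \<in> {..<Suc n}"
        then have "i < Suc n" by simp
        moreover from this have "U n i \<noteq> {}" by (simp add: U_def field_simps)
        ultimately show "diam_pow s (U n i) = ennreal ((1 / real (Suc n)) powr s)"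
          using s diam by (simp add: diam_pow_def)
      qed simp
      also have "\<dots> = ennreal (real (Suc n) * (1 / real (Suc n)) powr s)"
        by (simp add: ennreal_mult ennreal_of_nat_eq_real_of_nat del: of_nat_Suc)
      also have "real (Suc n) * (1 / real (Suc n)) powr s = real (Suc n) powr (1 - s)"
        by (simp add: powr_divide powr_diff del: of_nat_Suc)
      finally show ?thesis .
    qed
    have "(\<lambda>n. real (Suc n) powr (1 - s)) \<longlonglongrightarrow> 0"
      using s by (intro tendsto_neg_powr filterlim_compose[OF filterlim_real_sequentially filterlim_Suc]) auto
    then have "(\<lambda>n. ennreal (real (Suc n) powr (1 - s))) \<longlonglongrightarrow> 0"
      by (metis ennreal_0 tendsto_ennrealI)
    moreover have "\<forall>\<^sub>F n in sequentially. 1 / real (Suc n) \<le> \<delta>"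
      using order_tendstoD(2)[OF LIMSEQ_inverse_real_of_nat \<delta>]
      by (rule eventually_mono) (simp add: inverse_eq_divide)
    then have "\<forall>\<^sub>F n in sequentially. hausdorff_content s \<delta> A \<le> ennreal (real (Suc n) powr (1 - s))"
      by (rule eventually_mono) (rule bound)
    ultimately show ?thesis by (rule tendsto_lowerbound) simp
  qed
  then have "hausdorff_outer s A \<le> 0"
    unfolding hausdorff_outer_def by (intro SUP_least) auto
  then show ?thesis by simp
qed

end

theory Submission
  imports Defs
begin

text \<open>
  The Gauss map \<open>x \<mapsto> frac (1 / x)\<close> is inverted on a cylinder of order \<open>n\<close> with denominator \<open>q\<close> by a
  Moebius map that contracts distances by a factor between \<open>1 / (4 * q\<^sup>2)\<close> and \<open>1 / q\<^sup>2\<close>.  Hence the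
  \<open>n\<close>-th digit is, up to the factor \<open>4 powr h\<close>, independent of the earlier ones and distributed like
  the first.  As \<open>I\<close> is infinite, \<open>0\<close> lies in the support of \<open>\<mu>\<close>, and regularity at \<open>0\<close> says that the
  first digit is at least \<open>N\<close> with probability comparable to \<open>N powr - h\<close>.

  The \<open>n\<close>-th convergent is at distance comparable to \<open>1 / (q\<^sub>n\<^sup>2 * a\<^sub>n)\<close>, \<open>a\<^sub>n\<close> being the next digit; so, by Legendre's
  theorem, \<open>x\<close> is \<open>\<psi>\<close>-approximable iff essentially \<open>a\<^sub>n \<ge> 1 / f q\<^sub>n\<close> infinitely often, where
  \<open>f q = q\<^sup>2 * \<psi> q\<close>.  Denominators always grow at least exponentially, and almost surely at most
  exponentially because the digits have finite moments of order less than \<open>h\<close>.  Since \<open>f\<close> is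
  monotone, both directions follow from Borel-Cantelli arguments for \<open>a\<^sub>n \<ge> 1 / f (2 ^ (b * n))\<close>, as
  the given series converges iff the sum of \<open>f (2 ^ n) powr h\<close> does.
\<close>

section \<open>Continued fractions and the Gauss map\<close>

definition unit_irrationals :: "real set" where
  "unit_irrationals = {0<..<1} - \<rat>"

definition gauss :: "real \<Rightarrow> real" where
  "gauss x = frac (1 / x)"

definition digit :: "nat \<Rightarrow> real \<Rightarrow> nat" where
  "digit n x = nat \<lfloor>1 / (gauss ^^ n) x\<rfloor>"

text \<open>
  The indices are shifted by one, so that the \<open>n\<close>-th convergent
  \<open>[0; \<omega> 0, \<dots>, \<omega> (n - 1)]\<close> is \<open>cnum \<omega> (Suc n) / cden \<omega> (Suc n)\<close>.
\<close>
fun cnum :: "(nat \<Rightarrow> nat) \<Rightarrow> nat \<Rightarrow> nat" where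
  "cnum \<omega> 0 = 1"
| "cnum \<omega> (Suc 0) = 0"
| "cnum \<omega> (Suc (Suc n)) = \<omega> n * cnum \<omega> (Suc n) + cnum \<omega> n"

fun cden :: "(nat \<Rightarrow> nat) \<Rightarrow> nat \<Rightarrow> nat" where
  "cden \<omega> 0 = 0"
| "cden \<omega> (Suc 0) = 1"
| "cden \<omega> (Suc (Suc n)) = \<omega> n * cden \<omega> (Suc n) + cden \<omega> n"

text \<open>The inverse branch of the \<open>n\<close>-th iterate of \<open>gauss\<close> that
  prepends the first \<open>n\<close> entries of \<open>\<omega>\<close> to the tail
  \<open>y\<close>. Its value at \<open>0\<close> is the \<open>n\<close>-th convergent.\<close>

definition cf_branch :: "(nat \<Rightarrow> nat) \<Rightarrow> nat \<Rightarrow> real \<Rightarrow> real" where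
  "cf_branch \<omega> n y =
     (real (cnum \<omega> (Suc n)) + real (cnum \<omega> n) * y) / (real (cden \<omega> (Suc n)) + real (cden \<omega> n) * y)"

lemma gauss_in:
  assumes "x \<in> unit_irrationals"
  shows "gauss x \<in> unit_irrationals"
proof -
  have "1 / x \<notin> \<rat>"
    using assms Rats_inverse[of "1/x"] by (auto simp: unit_irrationals_def inverse_eq_divide)
  then have "frac (1 / x) \<notin> \<rat>"
    by (metis Rats_add Rats_of_int add.commute frac_def diff_add_cancel)
  moreover from this have "frac (1 / x) \<noteq> 0" by (metis Rats_0)
  ultimately show ?thesis
    using frac_ge_0[of "1/x"] frac_lt_1[of "1/x"]
    by (auto simp: unit_irrationals_def gauss_def less_le)
qed

lemma gauss_iterate_in: "x \<in> unit_irrationals \<Longrightarrow> (gauss ^^ n) x \<in> unit_irrationals"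
  by (induction n) (auto simp: gauss_in)

lemma digit_gauss: "digit i ((gauss ^^ n) x) = digit (i + n) x"
  by (simp add: digit_def funpow_add)

lemma one_le_floor_inverse: "x \<in> unit_irrationals \<Longrightarrow> 1 \<le> \<lfloor>1 / x\<rfloor>"
  by (auto simp: unit_irrationals_def le_floor_iff field_simps)

lemma digit_pos: "x \<in> unit_irrationals \<Longrightarrow> 1 \<le> digit n x"
  using one_le_floor_inverse[OF gauss_iterate_in[of x n]] unfolding digit_def by linarith

lemma gauss_step:
  assumes "x \<in> unit_irrationals"
  shows "x = 1 / (real (digit 0 x) + gauss x)"
proof -
  have "real (nat \<lfloor>1 / x\<rfloor>) = of_int \<lfloor>1 / x\<rfloor>"
    using one_le_floor_inverse[OF assms] by linarith
  then have "real (digit 0 x) + gauss x = 1 / x"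
    by (simp add: digit_def gauss_def frac_def)
  then show ?thesis by simp
qed

lemma gauss_iterate_step:
  assumes "x \<in> unit_irrationals"
  shows "(gauss ^^ n) x = 1 / (real (digit n x) + (gauss ^^ Suc n) x)"
  using gauss_step[OF gauss_iterate_in[OF assms, of n]] by (simp add: digit_gauss)

lemma gauss_prepend:
  assumes i: "1 \<le> i" and y: "y \<in> unit_irrationals"
  shows "1 / (real i + y) \<in> unit_irrationals"
    and "digit 0 (1 / (real i + y)) = i"
    and "gauss (1 / (real i + y)) = y"
proof -
  have y01: "0 < y" "y < 1" "y \<notin> \<rat>" using y by (auto simp: unit_irrationals_def)
  have fl: "\<lfloor>real i + y\<rfloor> = int i" using y01 by linarith
  show "digit 0 (1 / (real i + y)) = i" by (simp add: digit_def fl)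
  show "gauss (1 / (real i + y)) = y" by (simp add: gauss_def frac_def fl)
  have "1 / (real i + y) \<notin> \<rat>"
  proof
    assume "1 / (real i + y) \<in> \<rat>"
    then have "inverse (1 / (real i + y)) \<in> \<rat>" by (rule Rats_inverse)
    then have "(real i + y) - real i \<in> \<rat>" by (intro Rats_diff) auto
    then show False using y01 by simp
  qed
  then show "1 / (real i + y) \<in> unit_irrationals"
    using i y01 by (simp add: unit_irrationals_def)
qed

section \<open>Continuants and inverse branches\<close>

lemma cden_pos: "1 \<le> cden \<omega> (Suc n)" if "\<And>i. i < n \<Longrightarrow> 1 \<le> \<omega> i"
  using that
proof (induction n)
  case (Suc n)
  then have "1 \<le> cden \<omega> (Suc n)" "1 \<le> \<omega> n" by auto
  then show ?case by (simp add: Suc_le_eq)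
qed simp

lemma cden_le_Suc: "cden \<omega> n \<le> cden \<omega> (Suc n)" if "\<And>i. i < n \<Longrightarrow> 1 \<le> \<omega> i"
proof (cases n)
  case (Suc m)
  then have "1 \<le> \<omega> m" using that by simp
  then have "1 * cden \<omega> (Suc m) \<le> \<omega> m * cden \<omega> (Suc m) + cden \<omega> m"
    by (intro trans_le_add1 mult_le_mono1)
  then show ?thesis by (simp only: Suc cden.simps mult_1)
qed simp

text \<open>Each new denominator is at least the sum of the previous two, so two steps at least
  double it.\<close>

lemma cden_ge_power: "2 ^ (n div 2) \<le> cden \<omega> (Suc n)" if "\<And>i. 1 \<le> \<omega> i"
proof (induction n rule: induct_nat_012)
  case (ge2 n)
  have "2 * cden \<omega> (Suc n) \<le> cden \<omega> (Suc (Suc n)) + cden \<omega> (Suc n)"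
    using cden_le_Suc[of "Suc n" \<omega>] that by simp
  also have "\<dots> \<le> cden \<omega> (Suc (Suc (Suc n)))"
    using mult_le_mono1[OF that[of "Suc n"], of "cden \<omega> (Suc (Suc n))"] by simp
  finally show ?case using ge2 by simp
next
  case 1
  then show ?case using that[of 0] by simp
qed simp

lemma cden_le_prod:
  assumes "\<And>i. 1 \<le> \<omega> i"
  shows "cden \<omega> (Suc n) \<le> (\<Prod>i<n. \<omega> i + 1)"
proof (induction n)
  case (Suc n)
  have "cden \<omega> (Suc (Suc n)) \<le> (\<omega> n + 1) * cden \<omega> (Suc n)"
    using cden_le_Suc[of n \<omega>] assms by simp
  also have "\<dots> \<le> (\<omega> n + 1) * (\<Prod>i<n. \<omega> i + 1)"
    by (rule mult_le_mono2[OF Suc])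
  finally show ?case by (simp add: mult.commute)
qed simp

text \<open>One step of the recursion multiplies the matrix of two consecutive pairs by one of
  determinant \<open>-1\<close>.\<close>

lemma cnum_cden_det:
  "int (cnum \<omega> n) * int (cden \<omega> (Suc n)) - int (cnum \<omega> (Suc n)) * int (cden \<omega> n) = (-1) ^ n"
  by (induction n) (simp_all add: algebra_simps)

lemma cnum_cden_coprime: "coprime (int (cnum \<omega> n)) (int (cden \<omega> n))"
proof (rule coprimeI)
  fix c assume "c dvd int (cnum \<omega> n)" "c dvd int (cden \<omega> n)"
  then have "c dvd int (cnum \<omega> n) * int (cden \<omega> (Suc n)) - int (cnum \<omega> (Suc n)) * int (cden \<omega> n)"
    by (intro dvd_diff dvd_mult dvd_mult2)
  then have "c dvd (-1) ^ n" by (simp only: cnum_cden_det)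
  then show "is_unit c" by (cases "even n") auto
qed

lemma cf_branch_Suc:
  assumes "1 \<le> \<omega> n" "0 \<le> y"
  shows "cf_branch \<omega> (Suc n) y = cf_branch \<omega> n (1 / (real (\<omega> n) + y))"
proof -
  have nz: "real (\<omega> n) + y \<noteq> 0" using assms by linarith
  have *: "a + b * (1 / (real (\<omega> n) + y)) = (real (\<omega> n) * a + b + a * y) / (real (\<omega> n) + y)" for a b
    using nz by (simp add: field_simps)
  show ?thesis unfolding cf_branch_def * using nz by simp
qed

text \<open>As \<open>cden \<omega> n \<le> cden \<omega> (Suc n)\<close>, the denominator of the
  Moebius map varies by at most a factor \<open>2\<close> on the unit interval. Squared, this is the
  \<open>4\<close> in the quasi-independence constant.\<close>

lemma cf_branch_denom_bounds:
  assumes "\<And>i. i < n \<Longrightarrow> 1 \<le> \<omega> i" "0 \<le> y" "y \<le> 1"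
  shows "real (cden \<omega> (Suc n)) \<le> real (cden \<omega> (Suc n)) + real (cden \<omega> n) * y"
    and "real (cden \<omega> (Suc n)) + real (cden \<omega> n) * y \<le> 2 * real (cden \<omega> (Suc n))"
proof -
  have "real (cden \<omega> n) * y \<le> real (cden \<omega> (Suc n)) * 1"
    using assms cden_le_Suc[of n \<omega>] by (intro mult_mono) auto
  then show "real (cden \<omega> (Suc n)) + real (cden \<omega> n) * y \<le> 2 * real (cden \<omega> (Suc n))" by simp
qed (use assms in simp)

text \<open>Two values of a Moebius map differ by the determinant times \<open>y - z\<close> over
  the product of their denominators; here the determinant is a sign.\<close>

lemma cf_branch_dist:
  assumes pos: "\<And>i. i < n \<Longrightarrow> 1 \<le> \<omega> i" and y: "0 \<le> y" and z: "0 \<le> z"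
  shows "\<bar>cf_branch \<omega> n y - cf_branch \<omega> n z\<bar> = \<bar>y - z\<bar> /
     ((real (cden \<omega> (Suc n)) + real (cden \<omega> n) * y) * (real (cden \<omega> (Suc n)) + real (cden \<omega> n) * z))"
proof -
  define p p' q q' where pq: "p = real (cnum \<omega> (Suc n))" "p' = real (cnum \<omega> n)"
    "q = real (cden \<omega> (Suc n))" "q' = real (cden \<omega> n)"
  have q: "1 \<le> q" "0 \<le> q'" using cden_pos[of n \<omega>] pos by (auto simp: pq simp del: cden.simps)
  then have nz: "0 < q + q' * y" "0 < q + q' * z"
    using y z by (auto intro: add_pos_nonneg)
  have "real_of_int (int (cnum \<omega> n) * int (cden \<omega> (Suc n)) - int (cnum \<omega> (Suc n)) * int (cden \<omega> n))
      = (-1) ^ n" by (simp only: cnum_cden_det) simp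
  then have det: "p' * q - p * q' = (-1) ^ n" by (simp add: pq)
  have "cf_branch \<omega> n y - cf_branch \<omega> n z = (p' * q - p * q') * (y - z) / ((q + q' * y) * (q + q' * z))"
  proof -
    have "cf_branch \<omega> n y - cf_branch \<omega> n z
        = ((p + p' * y) * (q + q' * z) - (p + p' * z) * (q + q' * y)) / ((q + q' * y) * (q + q' * z))"
      unfolding cf_branch_def pq[symmetric] by (rule diff_frac_eq) (use nz in auto)
    also have "(p + p' * y) * (q + q' * z) - (p + p' * z) * (q + q' * y) = (p' * q - p * q') * (y - z)"
      by (simp add: algebra_simps)
    finally show ?thesis .
  qed
  then show ?thesis using nz unfolding det pq[symmetric]
    by (simp add: abs_mult power_abs)
qed

lemma cf_branch_gauss:
  assumes "x \<in> unit_irrationals"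
  shows "cf_branch (\<lambda>i. digit i x) n ((gauss ^^ n) x) = x"
proof (induction n)
  case 0
  then show ?case by (simp add: cf_branch_def)
next
  case (Suc n)
  have "0 \<le> (gauss ^^ Suc n) x"
    using gauss_iterate_in[OF assms, of "Suc n"] by (auto simp: unit_irrationals_def)
  then have "cf_branch (\<lambda>i. digit i x) (Suc n) ((gauss ^^ Suc n) x)
      = cf_branch (\<lambda>i. digit i x) n (1 / (real (digit n x) + (gauss ^^ Suc n) x))"
    using digit_pos[OF assms] by (intro cf_branch_Suc)
  then show ?case
    by (simp only: gauss_iterate_step[OF assms, of n, symmetric] Suc)
qed

text \<open>\<open>x\<close> and its convergent are values of one branch, at
  \<open>(gauss ^^ n) x\<close> and at \<open>0\<close>, so \<open>cf_branch_dist\<close> gives the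
  exact error. The bounds then follow from \<open>0 < z < 1\<close> and
  \<open>0 \<le> q' \<le> q\<close>.\<close>

lemma convergent_error:
  fixes x :: real and n :: nat
  assumes x: "x \<in> unit_irrationals"
  defines "q \<equiv> real (cden (\<lambda>i. digit i x) (Suc n))"
  defines "e \<equiv> \<bar>x - real (cnum (\<lambda>i. digit i x) (Suc n)) / q\<bar>"
  shows "e \<le> 1 / (q\<^sup>2 * real (digit n x))"
    and "1 / (q\<^sup>2 * (real (digit n x) + 2)) \<le> e"
proof -
  define q' where "q' = real (cden (\<lambda>i. digit i x) n)"
  define y where "y = (gauss ^^ n) x"
  define a z where "a = real (digit n x)" and "z = (gauss ^^ Suc n) x"
  have pos: "\<And>i. 1 \<le> digit i x" using digit_pos[OF x] .
  have y: "0 < y" "y < 1" and z: "0 < z" "z < 1"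
    using gauss_iterate_in[OF x, of n] gauss_iterate_in[OF x, of "Suc n"]
    by (auto simp: unit_irrationals_def y_def z_def)
  have yz: "y = 1 / (a + z)" using gauss_iterate_step[OF x, of n] by (simp add: y_def a_def z_def)
  have a: "1 \<le> a" using pos[of n] by (simp add: a_def)
  have q: "1 \<le> q" using cden_pos[of n "\<lambda>i. digit i x"] pos by (simp add: q_def del: cden.simps)
  have q': "0 \<le> q'" "q' \<le> q" using cden_le_Suc[of n "\<lambda>i. digit i x"] pos
    by (auto simp: q'_def q_def simp del: cden.simps)
  have "e = \<bar>cf_branch (\<lambda>i. digit i x) n y - cf_branch (\<lambda>i. digit i x) n 0\<bar>"
    using cf_branch_gauss[OF x, of n] by (simp add: e_def y_def cf_branch_def q_def)
  also have "\<dots> = \<bar>y - 0\<bar> / ((q + q' * y) * (q + q' * 0))"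
    unfolding q_def q'_def by (rule cf_branch_dist) (use pos y in auto)
  also have "\<dots> = y / ((q + q' * y) * q)" using y by simp
  also have "\<dots> = 1 / (q * (q * (a + z) + q'))"
  proof -
    have "(q + q' * y) = (q * (a + z) + q') / (a + z)" using a z unfolding yz by (simp add: field_simps)
    then show ?thesis using a z unfolding yz by simp
  qed
  finally have e: "e = 1 / (q * (q * (a + z) + q'))" .
  have "q\<^sup>2 * a \<le> q * (q * (a + z) + q')"
    using q q' z by (simp add: power2_eq_square algebra_simps)
  then show "e \<le> 1 / (q\<^sup>2 * real (digit n x))"
    unfolding e a_def[symmetric] using q q' a z
    by (intro divide_left_mono) (auto intro!: mult_pos_pos add_pos_nonneg)
  have "q * (a + z) + q' \<le> q * (a + 2)"
  proof -
    have "q * z \<le> q * 1" using q z by (intro mult_left_mono) auto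
    then show ?thesis using q' by (simp add: algebra_simps)
  qed
  then have "q * (q * (a + z) + q') \<le> q * (q * (a + 2))" using q by (intro mult_left_mono) auto
  then show "1 / (q\<^sup>2 * (real (digit n x) + 2)) \<le> e"
    unfolding e a_def[symmetric] using q q' a z
    by (intro divide_left_mono) (auto simp: power2_eq_square mult.assoc intro!: mult_pos_pos add_pos_nonneg)
qed

section \<open>Hausdorff measure under Lipschitz maps\<close>

text \<open>The images of a cover of \<open>A\<close> cover the image, with diameters at most
  \<open>L\<close> times as large. The change of scale from \<open>\<delta> / L\<close> to
  \<open>\<delta>\<close> disappears in the supremum over scales.\<close>

lemma hausdorff_outer_lipschitz:
  fixes f :: "'a::metric_space \<Rightarrow> 'b::metric_space"
  assumes s: "0 < s" and L: "0 < L"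
    and lip: "\<And>x y. x \<in> A \<Longrightarrow> y \<in> A \<Longrightarrow> dist (f x) (f y) \<le> L * dist x y"
  shows "hausdorff_outer s (f ` A) \<le> ennreal (L powr s) * hausdorff_outer s A"
proof -
  have content: "hausdorff_content s \<delta> (f ` A) \<le> ennreal (L powr s) * hausdorff_content s (\<delta> / L) A"
    if \<delta>: "0 < \<delta>" for \<delta>
  proof -
    have inv: "ennreal (L powr s) * ennreal ((1 / L) powr s) = 1"
      using L by (simp add: ennreal_mult[symmetric] powr_mult[symmetric])
    \<comment> \<open>The constant is moved to the left by its inverse, so that the right-hand side
      is a bare infimum over covers.\<close>
    have "ennreal ((1 / L) powr s) * hausdorff_content s \<delta> (f ` A) \<le> hausdorff_content s (\<delta> / L) A"
      unfolding hausdorff_content_def[of s "\<delta> / L" A]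
    proof (rule INF_greatest)
      fix U assume U: "U \<in> small_covers (\<delta> / L) A"
      \<comment> \<open>Each piece is cut down to \<open>A\<close>, since \<open>f\<close> is
        controlled only there.\<close>
      define V where "V i = f ` (U i \<inter> A)" for i
      have bU: "bounded (U i)" and dU: "diameter (U i) \<le> \<delta> / L" for i
        using U by (auto simp: small_covers_def)
      have dist_V: "dist u v \<le> L * diameter (U i)" if uv: "u \<in> V i" "v \<in> V i" for u v i
      proof -
        from uv obtain x y where xy: "x \<in> U i" "x \<in> A" "y \<in> U i" "y \<in> A" "u = f x" "v = f y"
          by (auto simp: V_def)
        have "dist u v \<le> L * dist x y" using xy lip by simp
        also have "\<dots> \<le> L * diameter (U i)"
          using L bU xy by (intro mult_left_mono diameter_bounded_bound) auto
        finally show ?thesis .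
      qed
      have bV: "bounded (V i)" for i
        using dist_V[of _ i] unfolding bounded_any_center bounded_two_points by blast
      have dV: "diameter (V i) \<le> L * diameter (U i)" for i
        using dist_V L diameter_ge_0[OF bU] unfolding diameter_def[of "V i"]
        by (auto intro!: cSUP_least)
      have "V \<in> small_covers \<delta> (f ` A)"
      proof -
        have "diameter (V i) \<le> \<delta>" for i
          using order_trans[OF dV mult_left_mono[OF dU, of L i]] L by simp
        moreover have "f ` A \<subseteq> (\<Union>i. V i)" using U unfolding small_covers_def V_def by blast
        ultimately show ?thesis using bV by (simp add: small_covers_def)
      qed
      then have "hausdorff_content s \<delta> (f ` A) \<le> (\<Sum>i. diam_pow s (V i))"
        by (rule hausdorff_content_le)
      also have "\<dots> \<le> (\<Sum>i. ennreal (L powr s) * diam_pow s (U i))"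
      proof (intro suminf_le allI)
        fix i
        have "diameter (V i) powr s \<le> (L * diameter (U i)) powr s"
          using dV s diameter_ge_0[OF bV] by (intro powr_mono2) auto
        also have "\<dots> = L powr s * diameter (U i) powr s"
          using L diameter_ge_0[OF bU] by (simp add: powr_mult)
        finally show "diam_pow s (V i) \<le> ennreal (L powr s) * diam_pow s (U i)"
          using s unfolding diam_pow_def by (auto simp: V_def ennreal_mult[symmetric] intro!: ennreal_leI)
      qed auto
      also have "\<dots> = ennreal (L powr s) * (\<Sum>i. diam_pow s (U i))" by simp
      finally have "ennreal ((1 / L) powr s) * hausdorff_content s \<delta> (f ` A)
          \<le> ennreal ((1 / L) powr s) * (ennreal (L powr s) * (\<Sum>i. diam_pow s (U i)))"
        by (intro mult_left_mono) auto
      then show "ennreal ((1 / L) powr s) * hausdorff_content s \<delta> (f ` A) \<le> (\<Sum>i. diam_pow s (U i))"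
        using inv by (simp add: mult.assoc[symmetric] mult.commute)
    qed
    then have "ennreal (L powr s) * (ennreal ((1 / L) powr s) * hausdorff_content s \<delta> (f ` A))
        \<le> ennreal (L powr s) * hausdorff_content s (\<delta> / L) A"
      by (intro mult_left_mono) auto
    then show ?thesis by (simp add: mult.assoc[symmetric] inv)
  qed
  show ?thesis
    unfolding hausdorff_outer_def[of s "f ` A"]
  proof (rule SUP_least)
    fix \<delta> :: real assume "\<delta> \<in> {0<..}"
    then have "hausdorff_content s \<delta> (f ` A) \<le> ennreal (L powr s) * hausdorff_content s (\<delta> / L) A"
      using content by simp
    also have "\<dots> \<le> ennreal (L powr s) * hausdorff_outer s A"
      using \<open>\<delta> \<in> {0<..}\<close> L by (intro mult_left_mono hausdorff_content_le_outer) auto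
    finally show "hausdorff_content s \<delta> (f ` A) \<le> ennreal (L powr s) * hausdorff_outer s A" .
  qed
qed

text \<open>An expanding map is injective on \<open>A\<close>, and its inverse is Lipschitz with
  constant \<open>1 / L\<close>.\<close>

lemma hausdorff_outer_expanding:
  fixes f :: "'a::metric_space \<Rightarrow> 'b::metric_space"
  assumes s: "0 < s" and L: "0 < L"
    and exp: "\<And>x y. x \<in> A \<Longrightarrow> y \<in> A \<Longrightarrow> L * dist x y \<le> dist (f x) (f y)"
  shows "ennreal (L powr s) * hausdorff_outer s A \<le> hausdorff_outer s (f ` A)"
proof -
  have inj: "inj_on f A"
  proof (rule inj_onI)
    fix x y assume "x \<in> A" "y \<in> A" "f x = f y"
    then have "L * dist x y \<le> 0" using exp[of x y] by simp
    then show "x = y" using L by (simp add: mult_le_0_iff)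
  qed
  have "hausdorff_outer s (inv_into A f ` f ` A) \<le> ennreal ((1 / L) powr s) * hausdorff_outer s (f ` A)"
    using inj exp L by (intro hausdorff_outer_lipschitz[OF s]) (auto simp: field_simps)
  then have "ennreal (L powr s) * hausdorff_outer s A
      \<le> ennreal (L powr s) * (ennreal ((1 / L) powr s) * hausdorff_outer s (f ` A))"
    using inj by (intro mult_left_mono) auto
  also have "\<dots> = ennreal (L powr s * (1 / L) powr s) * hausdorff_outer s (f ` A)"
    by (simp add: ennreal_mult mult.assoc)
  also have "L powr s * (1 / L) powr s = 1" using L by (simp add: powr_mult[symmetric])
  finally show ?thesis by simp
qed


section \<open>Legendre's theorem\<close>

text \<open>Take consecutive denominators with \<open>Q \<le> q < Q'\<close>. By unimodularity
  \<open>(p, q)\<close> is an integer combination of the two convergents. The product of its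
  coefficients is nonpositive, as is that of the errors \<open>d\<close> and \<open>d'\<close>, so
  nothing cancels and \<open>\<bar>d\<bar>\<close> is at most
  \<open>\<bar>real q * x - of_int p\<bar>\<close>. Closeness then forces the fraction to equal the
  convergent.\<close>

lemma legendre:
  fixes p :: int and q :: nat
  assumes x: "x \<in> unit_irrationals" and q: "1 \<le> q" and pq: "coprime p (int q)"
    and close: "\<bar>x - of_int p / real q\<bar> < 1 / (2 * (real q)\<^sup>2)"
  shows "\<exists>n. p = int (cnum (\<lambda>i. digit i x) (Suc n)) \<and> q = cden (\<lambda>i. digit i x) (Suc n)"
proof -
  define \<omega> where "\<omega> = (\<lambda>i. digit i x)"
  have pos: "\<And>i. 1 \<le> \<omega> i" using digit_pos[OF x] by (simp add: \<omega>_def)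
  have "\<exists>m. q < cden \<omega> (Suc m)"
  proof -
    have "q < 2 ^ q" by (rule less_exp)
    also have "\<dots> \<le> cden \<omega> (Suc (2 * q))" using cden_ge_power[OF pos, of "2 * q"] by simp
    finally show ?thesis by blast
  qed
  define m where "m = (LEAST m. q < cden \<omega> (Suc m))"
  have m: "q < cden \<omega> (Suc m)" unfolding m_def by (rule LeastI_ex) fact
  have "m \<noteq> 0" using m q by (cases m) auto
  then obtain n where mn: "m = Suc n" by (cases m) auto
  have "\<not> q < cden \<omega> (Suc n)" using not_less_Least[of n "\<lambda>m. q < cden \<omega> (Suc m)"] mn by (simp add: m_def)
  then have nq: "cden \<omega> (Suc n) \<le> q" by simp
  define P Q P' Q' where PQ: "P = int (cnum \<omega> (Suc n))" "Q = int (cden \<omega> (Suc n))"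
    "P' = int (cnum \<omega> (Suc (Suc n)))" "Q' = int (cden \<omega> (Suc (Suc n)))"
  have Qpos: "1 \<le> Q" "Q \<le> int q" "int q < Q'"
    using cden_pos[of n \<omega>] pos nq m by (auto simp: PQ mn simp del: cden.simps)
  define s where "s = (-1::int) ^ Suc n"
  have det: "P * Q' - P' * Q = s" unfolding PQ s_def by (rule cnum_cden_det)
  have ss: "s * s = 1" by (simp add: s_def flip: power_add mult_2)
  \<comment> \<open>Cramer's rule for the two linear equations below; the determinant
    \<open>s\<close> is its own inverse, so the solutions are integers.\<close>
  define \<alpha> \<beta> where "\<alpha> = s * (p * Q' - P' * int q)" and "\<beta> = s * (P * int q - p * Q)"
  have "\<alpha> * P + \<beta> * P' = s * (P * Q' - P' * Q) * p" by (simp add: \<alpha>_def \<beta>_def algebra_simps)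
  then have p_eq: "p = \<alpha> * P + \<beta> * P'" using ss by (simp add: det)
  have "\<alpha> * Q + \<beta> * Q' = s * (P * Q' - P' * Q) * int q" by (simp add: \<alpha>_def \<beta>_def algebra_simps)
  then have q_eq: "int q = \<alpha> * Q + \<beta> * Q'" using ss by (simp add: det)
  define d d' where "d = of_int Q * x - of_int P" and "d' = of_int Q' * x - of_int P'"
  have lin: "real q * x - of_int p = of_int \<alpha> * d + of_int \<beta> * d'"
  proof -
    have "real q = of_int \<alpha> * of_int Q + of_int \<beta> * of_int Q'"
      using arg_cong[OF q_eq, of real_of_int] by simp
    moreover have "real_of_int p = of_int \<alpha> * of_int P + of_int \<beta> * of_int P'"
      using arg_cong[OF p_eq, of real_of_int] by simp
    ultimately show ?thesis by (simp add: d_def d'_def algebra_simps)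
  qed
  \<comment> \<open>Solving the branch formula for \<open>x\<close> gives
    \<open>d' = - y * d\<close> with \<open>y\<close> positive: consecutive convergents lie on
    opposite sides of \<open>x\<close>.\<close>
  have opp: "d * d' \<le> 0"
  proof -
    define y where "y = (gauss ^^ Suc n) x"
    have y: "0 < y" using gauss_iterate_in[OF x, of "Suc n"] by (auto simp: unit_irrationals_def y_def)
    have "x = (of_int P' + of_int P * y) / (of_int Q' + of_int Q * y)"
      using cf_branch_gauss[OF x, of "Suc n"] unfolding cf_branch_def \<omega>_def[symmetric] PQ y_def by simp
    moreover have "0 < real_of_int Q' + of_int Q * y" using Qpos y by (intro add_pos_pos mult_pos_pos) auto
    ultimately have "x * (of_int Q' + of_int Q * y) = of_int P' + of_int P * y" by (simp add: field_simps)
    then have "d' = - y * d" by (simp add: d_def d'_def algebra_simps)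
    then have "d * d' = - y * (d * d)" by simp
    then show ?thesis using y by (simp only:) (intro mult_nonpos_nonneg, auto)
  qed
  have best: "\<bar>d\<bar> \<le> \<bar>real q * x - of_int p\<bar>"
  proof -
    \<comment> \<open>Otherwise \<open>Q'\<close> would divide the smaller positive number
      \<open>q\<close>.\<close>
    have "\<alpha> \<noteq> 0"
    proof
      assume "\<alpha> = 0"
      then have "int q = \<beta> * Q'" using q_eq by simp
      then have "Q' dvd int q" by simp
      then have "Q' \<le> int q" using q by (intro zdvd_imp_le) auto
      then show False using Qpos by simp
    qed
    \<comment> \<open>Equal signs would make \<open>q\<close> at least \<open>Q'\<close> or
      nonpositive.\<close>
    have ab: "\<alpha> * \<beta> \<le> 0"
    proof (rule ccontr)
      assume "\<not> \<alpha> * \<beta> \<le> 0"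
      then have "(0 < \<alpha> \<and> 0 < \<beta>) \<or> (\<alpha> < 0 \<and> \<beta> < 0)" by (auto simp: not_le zero_less_mult_iff)
      then show False
      proof
        assume a: "0 < \<alpha> \<and> 0 < \<beta>"
        then have "0 \<le> \<alpha> * Q" "1 * Q' \<le> \<beta> * Q'"
          using Qpos by (auto intro!: mult_right_mono)
        then show False using q_eq Qpos by linarith
      next
        assume "\<alpha> < 0 \<and> \<beta> < 0"
        then have "\<alpha> * Q \<le> 0" "\<beta> * Q' \<le> 0" using Qpos by (auto intro: mult_nonpos_nonneg)
        then show False using q_eq q by linarith
      qed
    qed
    have "0 \<le> (of_int \<alpha> * d) * (of_int \<beta> * d')"
    proof -
      have "real_of_int (\<alpha> * \<beta>) \<le> 0" using ab by (simp only: of_int_le_0_iff)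
      then have "0 \<le> real_of_int (\<alpha> * \<beta>) * (d * d')" using opp by (rule mult_nonpos_nonpos)
      then show ?thesis by (simp add: algebra_simps)
    qed
    moreover have "\<bar>u + v\<bar> = \<bar>u\<bar> + \<bar>v\<bar>" if "0 \<le> u * v" for u v :: real
      using that by (auto simp: zero_le_mult_iff)
    ultimately have "\<bar>of_int \<alpha> * d + of_int \<beta> * d'\<bar> = \<bar>of_int \<alpha> * d\<bar> + \<bar>of_int \<beta> * d'\<bar>"
      by blast
    moreover have "1 * \<bar>d\<bar> \<le> \<bar>of_int \<alpha>\<bar> * \<bar>d\<bar>"
      using \<open>\<alpha> \<noteq> 0\<close> by (intro mult_right_mono) auto
    moreover have "0 \<le> \<bar>of_int \<beta>\<bar> * \<bar>d'\<bar>" by simp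
    ultimately show ?thesis unfolding lin by (simp only: abs_mult)
  qed
  have qx: "\<bar>real q * x - of_int p\<bar> < 1 / (2 * real q)"
  proof -
    have "real q * x - of_int p = real q * (x - of_int p / real q)" using q by (simp add: algebra_simps)
    then have "\<bar>real q * x - of_int p\<bar> = real q * \<bar>x - of_int p / real q\<bar>" by (simp add: abs_mult)
    also have "\<dots> < real q * (1 / (2 * (real q)\<^sup>2))" using q close by (intro mult_strict_left_mono) auto
    also have "\<dots> = 1 / (2 * real q)" using q by (simp add: power2_eq_square)
    finally show ?thesis .
  qed
  \<comment> \<open>The determinant of the two fractions is an integer; once it is below
    \<open>1\<close> in absolute value it vanishes, and two reduced fractions of equal value
    coincide.\<close>
  have "\<bar>real_of_int (p * Q - P * int q)\<bar> < 1"
  proof -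
    have "real_of_int (p * Q - P * int q) = real q * d - of_int Q * (real q * x - of_int p)"
      by (simp add: d_def algebra_simps)
    then have "\<bar>real_of_int (p * Q - P * int q)\<bar> \<le> \<bar>real q * d\<bar> + \<bar>of_int Q * (real q * x - of_int p)\<bar>"
      by (simp only: abs_triangle_ineq4)
    also have "\<dots> = real q * \<bar>d\<bar> + of_int Q * \<bar>real q * x - of_int p\<bar>"
      using Qpos by (simp add: abs_mult)
    also have "\<dots> \<le> real q * \<bar>real q * x - of_int p\<bar> + real q * \<bar>real q * x - of_int p\<bar>"
      using best Qpos by (intro add_mono mult_left_mono mult_right_mono) auto
    also have "\<dots> = 2 * real q * \<bar>real q * x - of_int p\<bar>" by simp
    also have "\<dots> < 2 * real q * (1 / (2 * real q))" using q qx by (intro mult_strict_left_mono) auto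
    also have "\<dots> = 1" using q by simp
    finally show ?thesis .
  qed
  then have "\<bar>p * Q - P * int q\<bar> < 1" by (simp only: of_int_abs[symmetric] of_int_less_1_iff)
  then have eq: "p * Q = P * int q" by simp
  have cop: "coprime P Q" unfolding PQ by (rule cnum_cden_coprime)
  have "int q dvd Q"
    using eq pq by (metis coprime_commute coprime_dvd_mult_right_iff dvd_triv_right)
  moreover have "Q dvd int q"
    using eq cop by (metis coprime_commute coprime_dvd_mult_right_iff dvd_triv_right)
  ultimately have "Q = int q" using Qpos q by (intro zdvd_antisym_nonneg) auto
  moreover from this have "p = P" using eq q by simp
  ultimately show ?thesis unfolding PQ \<omega>_def by (intro exI[of _ n]) simp
qed

section \<open>Cylinders of the set of restricted continued fractions\<close>

lemma cf_conv_bounds: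
  assumes "\<And>i. 1 \<le> \<omega> i"
  shows "0 \<le> cf_conv \<omega> n \<and> cf_conv \<omega> n \<le> 1"
  using assms
proof (induction n arbitrary: \<omega>)
  case (Suc n)
  have "0 \<le> cf_conv (\<lambda>i. \<omega> (Suc i)) n" using Suc by simp
  moreover have "1 \<le> real (\<omega> 0)" using Suc.prems[of 0] by simp
  ultimately show ?case by simp
qed simp

lemma cf_set_subset: "cf_set I \<subseteq> unit_irrationals"
proof
  fix x assume "x \<in> cf_set I"
  then have "x \<in> {0..1} - \<rat>" by (simp add: cf_set_def)
  moreover from this have "x \<noteq> 0" "x \<noteq> 1" by (metis DiffD2 Rats_0, metis DiffD2 Rats_1)
  ultimately show "x \<in> unit_irrationals" by (simp add: unit_irrationals_def)
qed

lemma cf_set_prepend: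
  assumes i: "i \<in> I" "1 \<le> i" and y: "y \<in> cf_set I"
  shows "1 / (real i + y) \<in> cf_set I"
proof -
  from y obtain \<omega> where \<omega>: "cf_expansion y \<omega>" "\<And>j. \<omega> j \<in> I" by (auto simp: cf_set_def)
  have yu: "y \<in> unit_irrationals" using y cf_set_subset by blast
  then have "real i + y \<noteq> 0" using i by (auto simp: unit_irrationals_def)
  moreover have "cf_conv \<omega> \<longlonglongrightarrow> y" using \<omega> by (simp add: cf_expansion_def)
  ultimately have "(\<lambda>n. 1 / (real i + cf_conv \<omega> n)) \<longlonglongrightarrow> 1 / (real i + y)"
    by (intro tendsto_intros)
  then have "(\<lambda>n. cf_conv (case_nat i \<omega>) (Suc n)) \<longlonglongrightarrow> 1 / (real i + y)" by simp
  then have "cf_conv (case_nat i \<omega>) \<longlonglongrightarrow> 1 / (real i + y)" by (rule LIMSEQ_imp_Suc)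
  then have "cf_expansion (1 / (real i + y)) (case_nat i \<omega>)"
    using \<omega>(1) i by (auto simp: cf_expansion_def split: nat.split)
  moreover have "\<forall>j. case_nat i \<omega> j \<in> I" using i \<omega> by (auto split: nat.split)
  moreover have "1 / (real i + y) \<in> {0..1} - \<rat>"
    using gauss_prepend(1)[OF i(2) yu] by (auto simp: unit_irrationals_def)
  ultimately show ?thesis unfolding cf_set_def by blast
qed

text \<open>The entries in \<open>cf_set\<close> are known only through a limit. Inverting one step
  yields an irrational tail in the unit interval, which identifies the leading entry with the Gauss
  digit; iterating this identifies all entries.\<close>

lemma cf_set_gauss:
  assumes x: "x \<in> cf_set I"
  shows "gauss x \<in> cf_set I \<and> digit 0 x \<in> I"
proof -
  from x obtain \<omega> where \<omega>: "cf_expansion x \<omega>" "\<And>j. \<omega> j \<in> I" by (auto simp: cf_set_def)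
  have pos: "\<And>i. 1 \<le> \<omega> i" and lim: "cf_conv \<omega> \<longlonglongrightarrow> x" using \<omega> by (auto simp: cf_expansion_def)
  have xu: "x \<in> unit_irrationals" using x cf_set_subset by blast
  then have x0: "x \<noteq> 0" by (auto simp: unit_irrationals_def)
  define y where "y = 1 / x - real (\<omega> 0)"
  have "(\<lambda>n. 1 / cf_conv \<omega> (Suc n) - real (\<omega> 0)) \<longlonglongrightarrow> y"
    unfolding y_def using LIMSEQ_Suc[OF lim] x0 by (intro tendsto_intros)
  then have lim': "cf_conv (\<lambda>i. \<omega> (Suc i)) \<longlonglongrightarrow> y" by simp
  have y01: "0 \<le> y" "y \<le> 1"
    using cf_conv_bounds[of "\<lambda>i. \<omega> (Suc i)"] pos
    by (auto intro: LIMSEQ_le_const[OF lim'] LIMSEQ_le_const2[OF lim'])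
  have "y \<notin> \<rat>"
  proof
    assume "y \<in> \<rat>"
    then have "inverse (y + real (\<omega> 0)) \<in> \<rat>" by (intro Rats_inverse Rats_add) auto
    then show False using xu by (simp add: y_def unit_irrationals_def)
  qed
  moreover have "cf_expansion y (\<lambda>i. \<omega> (Suc i))" using lim' pos by (simp add: cf_expansion_def)
  moreover have "y \<in> {0..1}" using y01 by simp
  ultimately have yE: "y \<in> cf_set I" using \<omega>(2) unfolding cf_set_def by blast
  then have yu: "y \<in> unit_irrationals" using cf_set_subset by blast
  have "x = 1 / (real (\<omega> 0) + y)" by (simp add: y_def)
  then show ?thesis using gauss_prepend[OF pos[of 0] yu] yE \<omega>(2)[of 0] by simp
qed

lemma cf_set_gauss_iterate: "x \<in> cf_set I \<Longrightarrow> (gauss ^^ n) x \<in> cf_set I"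
  by (induction n) (auto simp: cf_set_gauss)

lemma cf_set_digit: "x \<in> cf_set I \<Longrightarrow> digit n x \<in> I"
  using cf_set_gauss[OF cf_set_gauss_iterate, of x I n] by (simp add: digit_gauss)

text \<open>Every finite word over \<open>I\<close> may precede every point of the set: the digits
  form a full shift. The induction puts the last entry of the word in front of \<open>y\<close>
  first.\<close>

lemma cf_branch_prepend:
  assumes "\<And>i. i < n \<Longrightarrow> \<omega> i \<in> I" "I \<subseteq> {1..}" "y \<in> cf_set I"
  shows "cf_branch \<omega> n y \<in> cf_set I \<and> (\<forall>i<n. digit i (cf_branch \<omega> n y) = \<omega> i)
           \<and> (gauss ^^ n) (cf_branch \<omega> n y) = y"
  using assms
proof (induction n arbitrary: y)
  case 0
  then show ?case by (simp add: cf_branch_def)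
next
  case (Suc n)
  define z where "z = 1 / (real (\<omega> n) + y)"
  have \<omega>n: "\<omega> n \<in> I" "1 \<le> \<omega> n" using Suc.prems by auto
  have yu: "y \<in> unit_irrationals" using Suc.prems cf_set_subset by blast
  have z: "z \<in> cf_set I" unfolding z_def using \<omega>n Suc.prems by (intro cf_set_prepend)
  have br: "cf_branch \<omega> (Suc n) y = cf_branch \<omega> n z"
    unfolding z_def using \<omega>n yu by (intro cf_branch_Suc) (auto simp: unit_irrationals_def)
  have IH: "cf_branch \<omega> n z \<in> cf_set I" "\<And>i. i < n \<Longrightarrow> digit i (cf_branch \<omega> n z) = \<omega> i"
    "(gauss ^^ n) (cf_branch \<omega> n z) = z"
    using Suc.IH[OF _ _ z] Suc.prems by auto
  have "digit n (cf_branch \<omega> n z) = digit 0 z"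
    using digit_gauss[of 0 n "cf_branch \<omega> n z"] IH(3) by simp
  moreover have "digit 0 z = \<omega> n" "gauss z = y"
    unfolding z_def using gauss_prepend[OF \<omega>n(2) yu] by auto
  ultimately show ?case using IH by (auto simp: br less_Suc_eq)
qed

lemma continuant_cong:
  assumes "\<And>i. i < n \<Longrightarrow> \<omega> i = \<omega>' i"
  shows "cnum \<omega> n = cnum \<omega>' n \<and> cnum \<omega> (Suc n) = cnum \<omega>' (Suc n)
       \<and> cden \<omega> n = cden \<omega>' n \<and> cden \<omega> (Suc n) = cden \<omega>' (Suc n)"
  using assms by (induction n) auto

lemma cf_branch_cong:
  assumes "\<And>i. i < n \<Longrightarrow> \<omega> i = \<omega>' i"
  shows "cf_branch \<omega> n = cf_branch \<omega>' n"
  using continuant_cong[OF assms] by (simp add: cf_branch_def fun_eq_iff)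

definition cylinder :: "(nat \<Rightarrow> nat) \<Rightarrow> nat \<Rightarrow> real set \<Rightarrow> real set" where
  "cylinder \<omega> n A = {x \<in> unit_irrationals. (\<forall>i<n. digit i x = \<omega> i) \<and> (gauss ^^ n) x \<in> A}"

text \<open>Within the set, a cylinder is a Moebius image of its tail set, which brings its measure
  under the Lipschitz bounds.\<close>

lemma cylinder_Int_cf_set:
  assumes "\<And>i. i < n \<Longrightarrow> \<omega> i \<in> I" "I \<subseteq> {1..}"
  shows "cylinder \<omega> n A \<inter> cf_set I = cf_branch \<omega> n ` (A \<inter> cf_set I)"
proof (rule set_eqI, rule iffI)
  fix x assume "x \<in> cylinder \<omega> n A \<inter> cf_set I"
  then have x: "x \<in> cf_set I" "x \<in> unit_irrationals" "\<And>i. i < n \<Longrightarrow> digit i x = \<omega> i" "(gauss ^^ n) x \<in> A"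
    by (auto simp: cylinder_def)
  have "cf_branch \<omega> n ((gauss ^^ n) x) = x"
    using cf_branch_gauss[OF x(2), of n] cf_branch_cong[of n "\<lambda>i. digit i x" \<omega>] x(3) by simp
  then show "x \<in> cf_branch \<omega> n ` (A \<inter> cf_set I)"
    using x cf_set_gauss_iterate[OF x(1), of n] by (metis IntI imageI)
next
  fix x assume "x \<in> cf_branch \<omega> n ` (A \<inter> cf_set I)"
  then obtain y where y: "y \<in> A" "y \<in> cf_set I" "x = cf_branch \<omega> n y" by blast
  then show "x \<in> cylinder \<omega> n A \<inter> cf_set I"
    using cf_branch_prepend[of n \<omega> I y] assms cf_set_subset[of I] by (auto simp: cylinder_def)
qed

lemma cylinder_Int_cf_set_empty:
  assumes "i < n" "\<omega> i \<notin> I"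
  shows "cylinder \<omega> n A \<inter> cf_set I = {}"
  using assms cf_set_digit[of _ I i] by (force simp: cylinder_def)

lemma gauss_measurable [measurable]: "gauss \<in> borel_measurable borel"
  unfolding gauss_def frac_def by measurable

lemma gauss_iterate_measurable [measurable]: "gauss ^^ n \<in> borel_measurable borel"
proof (induction n)
  case (Suc n)
  show ?case unfolding funpow.simps by (rule measurable_comp[OF Suc gauss_measurable])
qed (simp add: id_def)

lemma digit_measurable [measurable]: "digit n \<in> measurable borel (count_space UNIV)"
  unfolding digit_def by measurable

lemma unit_irrationals_measurable [measurable]: "unit_irrationals \<in> sets borel"
proof -
  have "\<rat> \<in> sets (borel :: real measure)"
    by (rule sets.countable) (auto simp: countable_rat)
  then show ?thesis unfolding unit_irrationals_def by simp
qed

lemma cylinder_measurable [measurable]: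
  assumes [measurable]: "A \<in> sets borel"
  shows "cylinder \<omega> n A \<in> sets borel"
  unfolding cylinder_def by measurable

section \<open>Quasi-independence of the digits\<close>

declare sets_hausdorff_on [measurable_cong]

text \<open>The branch changes distances by a factor between \<open>1 / (4 * q\<^sup>2)\<close> and
  \<open>1 / q\<^sup>2\<close>, and the measure scales with the \<open>h\<close>-th power. The
  factors do not depend on \<open>A\<close>, so \<open>q\<close> cancels when two tail sets are
  compared.\<close>

lemma cylinder_measure:
  assumes h: "0 < h" and \<omega>: "\<And>i. i < n \<Longrightarrow> \<omega> i \<in> I" and I: "I \<subseteq> {1..}"
    and A [measurable]: "A \<in> sets borel"
  defines "M \<equiv> hausdorff_on h (cf_set I)" and "q \<equiv> real (cden \<omega> (Suc n))"
  shows "emeasure M (cylinder \<omega> n A) \<le> ennreal ((1 / q\<^sup>2) powr h) * emeasure M A"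
    and "ennreal ((1 / (4 * q\<^sup>2)) powr h) * emeasure M A \<le> emeasure M (cylinder \<omega> n A)"
proof -
  have pos: "\<And>i. i < n \<Longrightarrow> 1 \<le> \<omega> i" using \<omega> I by force
  have q: "1 \<le> q" using cden_pos[of n \<omega>] pos by (simp add: q_def del: cden.simps)
  have cyl: "emeasure M (cylinder \<omega> n A) = hausdorff_outer h (cf_branch \<omega> n ` (A \<inter> cf_set I))"
    unfolding M_def by (subst emeasure_hausdorff_on) (simp_all add: cylinder_Int_cf_set[OF \<omega> I])
  have MA: "emeasure M A = hausdorff_outer h (A \<inter> cf_set I)"
    unfolding M_def by (simp add: emeasure_hausdorff_on)
  have bounds: "dist (cf_branch \<omega> n y) (cf_branch \<omega> n z) \<le> (1 / q\<^sup>2) * dist y z \<and>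
      (1 / (4 * q\<^sup>2)) * dist y z \<le> dist (cf_branch \<omega> n y) (cf_branch \<omega> n z)"
    if "y \<in> A \<inter> cf_set I" "z \<in> A \<inter> cf_set I" for y z
  proof -
    have y: "0 \<le> y" "y \<le> 1" and z: "0 \<le> z" "z \<le> 1"
      using that cf_set_subset[of I] by (auto simp: unit_irrationals_def)
    define D where "D t = q + real (cden \<omega> n) * t" for t
    have D: "q \<le> D y" "D y \<le> 2 * q" "q \<le> D z" "D z \<le> 2 * q"
      using cf_branch_denom_bounds[OF pos y] cf_branch_denom_bounds[OF pos z]
      by (auto simp: D_def q_def simp del: cden.simps)
    have eq: "dist (cf_branch \<omega> n y) (cf_branch \<omega> n z) = dist y z / (D y * D z)"
      using cf_branch_dist[OF pos y(1) z(1)] by (simp add: dist_real_def D_def q_def)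
    have "q\<^sup>2 \<le> D y * D z" "D y * D z \<le> (2 * q) * (2 * q)"
      unfolding power2_eq_square using D q by (intro mult_mono; simp)+
    moreover have "0 < q\<^sup>2" using q by simp
    ultimately have "dist y z / (D y * D z) \<le> dist y z / q\<^sup>2"
      "dist y z / ((2 * q) * (2 * q)) \<le> dist y z / (D y * D z)"
      using D q by (auto intro!: divide_left_mono mult_pos_pos)
    then show ?thesis unfolding eq by (simp add: power2_eq_square)
  qed
  show "emeasure M (cylinder \<omega> n A) \<le> ennreal ((1 / q\<^sup>2) powr h) * emeasure M A"
    unfolding cyl MA using q bounds by (intro hausdorff_outer_lipschitz[OF h]) auto
  show "ennreal ((1 / (4 * q\<^sup>2)) powr h) * emeasure M A \<le> emeasure M (cylinder \<omega> n A)"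
    unfolding cyl MA using q bounds by (intro hausdorff_outer_expanding[OF h]) auto
qed

text \<open>Words are lists because these are countable in number: an event on the first
  \<open>n\<close> digits is a countable union of cylinders, hence measurable for every
  predicate.\<close>

definition digits :: "nat \<Rightarrow> real \<Rightarrow> nat list" where
  "digits n x = map (\<lambda>i. digit i x) [0..<n]"

definition digit_event :: "nat \<Rightarrow> (nat list \<Rightarrow> bool) \<Rightarrow> real set \<Rightarrow> real set" where
  "digit_event n W A = {x \<in> unit_irrationals. W (digits n x) \<and> (gauss ^^ n) x \<in> A}"

lemma digit_event_eq_UN:
  "digit_event n W A = (\<Union>w\<in>{w. length w = n \<and> W w}. cylinder ((!) w) n A)"
proof (rule set_eqI, rule iffI)
  fix x assume "x \<in> digit_event n W A"
  then have "x \<in> cylinder ((!) (digits n x)) n A" "length (digits n x) = n" "W (digits n x)"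
    by (auto simp: digit_event_def cylinder_def digits_def)
  then show "x \<in> (\<Union>w\<in>{w. length w = n \<and> W w}. cylinder ((!) w) n A)" by blast
next
  fix x assume "x \<in> (\<Union>w\<in>{w. length w = n \<and> W w}. cylinder ((!) w) n A)"
  then obtain w where w: "length w = n" "W w" "x \<in> cylinder ((!) w) n A" by blast
  then have "digits n x = w" by (auto simp: cylinder_def digits_def intro: nth_equalityI)
  then show "x \<in> digit_event n W A" using w by (simp add: digit_event_def cylinder_def)
qed

lemma digit_event_measurable [measurable]:
  assumes [measurable]: "A \<in> sets borel"
  shows "digit_event n W A \<in> sets borel"
  unfolding digit_event_eq_UN by (rule sets.countable_UN') auto

lemma emeasure_digit_event:
  assumes A: "A \<in> sets borel" and M: "sets M = sets borel"
  shows "emeasure M (digit_event n W A)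
    = (\<integral>\<^sup>+w. emeasure M (cylinder ((!) w) n A) \<partial>count_space {w. length w = n \<and> W w})"
  unfolding digit_event_eq_UN
proof (rule emeasure_UN_countable)
  show "disjoint_family_on (\<lambda>w. cylinder ((!) w) n A) {w. length w = n \<and> W w}"
    unfolding disjoint_family_on_def by (auto simp: cylinder_def list_eq_iff_nth_eq)
qed (use A M in auto)

text \<open>Cylinders over the same word with two different tail sets are compared, and the
  comparison is summed over all words. Cross-multiplication avoids quotients of extended
  reals.\<close>

lemma quasi_independence:
  assumes h: "0 < h" and I: "I \<subseteq> {1..}" and A [measurable]: "A \<in> sets borel"
  defines "M \<equiv> hausdorff_on h (cf_set I)"
  shows "emeasure M (digit_event n W A) * emeasure M UNIV
      \<le> ennreal (4 powr h) * (emeasure M (digit_event n W UNIV) * emeasure M A)" (is ?upper)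
    and "emeasure M (digit_event n W UNIV) * emeasure M A
      \<le> ennreal (4 powr h) * (emeasure M (digit_event n W A) * emeasure M UNIV)" (is ?lower)
proof -
  \<comment> \<open>Stated for two arbitrary tail sets, so that \<open>A, UNIV\<close> and
    \<open>UNIV, A\<close> give the two directions.\<close>
  have *: "emeasure M (cylinder ((!) w) n B) * emeasure M B'
      \<le> ennreal (4 powr h) * (emeasure M (cylinder ((!) w) n B') * emeasure M B)"
    if w: "length w = n" and [measurable]: "B \<in> sets borel" "B' \<in> sets borel" for w B B'
  proof (cases "\<forall>i<n. w ! i \<in> I")
    case True
    define q where "q = real (cden ((!) w) (Suc n))"
    \<comment> \<open>\<open>4 powr h\<close> is the ratio of the two constants in
      \<open>cylinder_measure\<close>.\<close>
    have "ennreal (4 powr h) * ennreal ((1 / (4 * q\<^sup>2)) powr h) = ennreal ((4 * (1 / (4 * q\<^sup>2))) powr h)"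
      by (simp only: ennreal_mult powr_mult powr_ge_zero)
    then have k: "ennreal (4 powr h) * ennreal ((1 / (4 * q\<^sup>2)) powr h) = ennreal ((1 / q\<^sup>2) powr h)" by simp
    have "emeasure M (cylinder ((!) w) n B) * emeasure M B'
        \<le> (ennreal ((1 / q\<^sup>2) powr h) * emeasure M B) * emeasure M B'"
      unfolding M_def q_def using True by (intro mult_right_mono cylinder_measure(1)[OF h _ I]) auto
    also have "\<dots> = ennreal (4 powr h) * ((ennreal ((1 / (4 * q\<^sup>2)) powr h) * emeasure M B') * emeasure M B)"
      unfolding k[symmetric] by (simp add: mult_ac)
    also have "\<dots> \<le> ennreal (4 powr h) * (emeasure M (cylinder ((!) w) n B') * emeasure M B)"
      unfolding M_def q_def using True
      by (intro mult_left_mono mult_right_mono cylinder_measure(2)[OF h _ I]) auto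
    finally show ?thesis .
  next
    case False
    then obtain i where "i < n" "w ! i \<notin> I" by blast
    then have "emeasure M (cylinder ((!) w) n B) = 0"
      unfolding M_def using cylinder_Int_cf_set_empty[of i n "(!) w" I B]
      by (subst emeasure_hausdorff_on) simp_all
    then show ?thesis by simp
  qed
  let ?S = "count_space {w. length w = n \<and> W w}"
  have ev: "emeasure M (digit_event n W B) = (\<integral>\<^sup>+w. emeasure M (cylinder ((!) w) n B) \<partial>?S)"
    if "B \<in> sets borel" for B
    using that by (intro emeasure_digit_event) (simp_all add: M_def)
  have **: "emeasure M (digit_event n W B) * emeasure M B'
      \<le> ennreal (4 powr h) * (emeasure M (digit_event n W B') * emeasure M B)"
    if "B \<in> sets borel" "B' \<in> sets borel" for B B'
    unfolding ev[OF that(1)] ev[OF that(2)]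
    by (subst nn_integral_multc[symmetric] nn_integral_cmult[symmetric], simp)+
       (use * that in \<open>auto intro!: nn_integral_mono\<close>)
  show ?upper ?lower using **[of A UNIV] **[of UNIV A] by auto
qed

section \<open>Mass near the origin and the size of single digits\<close>

locale regular_cf_set =
  fixes I :: "nat set" and h :: real
  assumes I_pos: "I \<subseteq> {1..}" and I_inf: "infinite I"
    and reg: "ahlfors_regular h (hausdorff_on h (cf_set I))"
begin

abbreviation M :: "real measure" where
  "M \<equiv> hausdorff_on h (cf_set I)"

lemma h_pos: "0 < h"
  using reg by (simp add: ahlfors_regular_def)

lemma emeasure_M_cong:
  assumes "A \<in> sets borel" "B \<in> sets borel" "\<And>x. x \<in> cf_set I \<Longrightarrow> x \<in> A \<longleftrightarrow> x \<in> B"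
  shows "emeasure M A = emeasure M B"
proof -
  have "A \<inter> cf_set I = B \<inter> cf_set I" using assms(3) by blast
  then show ?thesis using assms by (simp add: emeasure_hausdorff_on)
qed

lemma AE_unit_irrationals: "AE x in M. x \<in> unit_irrationals"
proof (rule AE_I')
  have "emeasure M (- unit_irrationals) = emeasure M {}"
    using cf_set_subset[of I] by (intro emeasure_M_cong) auto
  then show "- unit_irrationals \<in> null_sets M" by (auto simp: null_sets_def)
qed auto

text \<open>\<open>I\<close> contains digits \<open>i\<close> beyond any bound, and the cylinder of
  first digit \<open>i\<close> lies between \<open>0\<close> and \<open>1 / real i\<close> and
  carries a positive share of the mass.\<close>

lemma zero_in_support: "0 \<in> measure_support M"
  unfolding measure_support_def
proof (intro CollectI allI impI)
  fix U :: "real set" assume U: "open U \<and> 0 \<in> U"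
  then obtain e where e: "0 < e" "ball 0 e \<subseteq> U" by (auto simp: open_contains_ball)
  obtain k where k: "1 / e < real k" using reals_Archimedean2 by blast
  obtain i where i: "i \<in> I" "k < i" using I_inf by (auto simp: infinite_nat_iff_unbounded)
  have "1 / e < real i" using k i by simp
  then have ie: "1 / real i < e" using e(1) i(2) by (simp add: field_simps)
  define C where "C = cylinder (\<lambda>_. i) 1 UNIV"
  have C[measurable]: "C \<in> sets borel" by (simp add: C_def)
  have "emeasure M UNIV \<noteq> 0" using reg by (simp add: ahlfors_regular_def)
  then have "0 < emeasure M UNIV" by (rule zero_less_iff_neq_zero[THEN iffD2])
  moreover have "0 < (1 / (4 * (real (cden (\<lambda>_. i) (Suc 1)))\<^sup>2)) powr h"
    using i I_pos by auto
  ultimately have "0 < ennreal ((1 / (4 * (real (cden (\<lambda>_. i) (Suc 1)))\<^sup>2)) powr h) * emeasure M UNIV"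
    by (simp add: ennreal_zero_less_mult_iff del: cden.simps)
  also have "\<dots> \<le> emeasure M C"
    unfolding C_def using i(1) by (intro cylinder_measure(2)[OF h_pos _ I_pos]) auto
  also have "\<dots> \<le> emeasure M U"
  proof (rule emeasure_mono)
    show "C \<subseteq> U"
    proof
      fix x assume "x \<in> C"
      then have x: "x \<in> unit_irrationals" "digit 0 x = i" by (auto simp: C_def cylinder_def)
      have g: "0 < gauss x" using gauss_in[OF x(1)] by (auto simp: unit_irrationals_def)
      have "x = 1 / (real i + gauss x)" using gauss_step[OF x(1)] x(2) by simp
      also have "\<dots> \<le> 1 / real i" using g i by (intro divide_left_mono) auto
      finally have "x < e" using ie by simp
      moreover have "0 < x" using x by (simp add: unit_irrationals_def)
      ultimately show "x \<in> U" using e by auto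
    qed
    show "U \<in> sets M" using U by simp
  qed
  finally show "0 < emeasure M U" .
qed

lemma ball_zero_bounds:
  obtains C1 C2 where "0 < C1" "0 < C2"
    "\<And>r. 0 < r \<Longrightarrow> r \<le> 1 \<Longrightarrow> ennreal (C1 * r powr h) \<le> emeasure M (ball 0 r)"
    "\<And>r. 0 < r \<Longrightarrow> r \<le> 1 \<Longrightarrow> emeasure M (ball 0 r) \<le> ennreal (C2 * r powr h)"
  using reg zero_in_support unfolding ahlfors_regular_def by blast

text \<open>The set lies in the ball of radius \<open>1\<close> about \<open>0\<close>, whose
  measure is bounded by regularity.\<close>

sublocale finite_measure M
proof
  obtain C2 where C2: "\<And>r. 0 < r \<Longrightarrow> r \<le> 1 \<Longrightarrow> emeasure M (ball 0 r) \<le> ennreal (C2 * r powr h)"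
    using ball_zero_bounds by metis
  have "emeasure M (space M) = emeasure M (ball 0 1)"
    using cf_set_subset[of I] by (intro emeasure_M_cong) (auto simp: unit_irrationals_def)
  also have "\<dots> < \<infinity>" using C2[of 1] by (auto simp: le_less_trans)
  finally show "emeasure M (space M) \<noteq> \<infinity>" by simp
qed

definition mass :: real where
  "mass = measure M UNIV"

lemma mass_pos: "0 < mass"
proof -
  have "emeasure M UNIV \<noteq> 0" using reg by (simp add: ahlfors_regular_def)
  then show ?thesis by (simp add: mass_def emeasure_eq_measure zero_less_measure_iff)
qed

lemma digit_event_bounds:
  assumes A: "A \<in> sets borel"
  shows "measure M (digit_event n W A) * mass \<le> 4 powr h * (measure M (digit_event n W UNIV) * measure M A)"
    and "measure M (digit_event n W UNIV) * measure M A \<le> 4 powr h * (measure M (digit_event n W A) * mass)"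
  using quasi_independence[OF h_pos I_pos A, of n W]
  by (simp_all add: emeasure_eq_measure mass_def ennreal_mult[symmetric])

text \<open>For irrational \<open>x\<close>, a first digit of at least \<open>N\<close> means
  \<open>x < 1 / real N\<close>. The event is thus a ball about \<open>0\<close>, where regularity
  gives both bounds.\<close>

lemma large_digit_bounds:
  obtains C1 C2 where "0 < C1" "0 < C2"
    "\<And>N. 1 \<le> N \<Longrightarrow> C1 * real N powr - h \<le> measure M {x \<in> unit_irrationals. N \<le> digit 0 x}"
    "\<And>N. 1 \<le> N \<Longrightarrow> measure M {x \<in> unit_irrationals. N \<le> digit 0 x} \<le> C2 * real N powr - h"
proof -
  have eq: "emeasure M {x \<in> unit_irrationals. N \<le> digit 0 x} = emeasure M (ball 0 (1 / real N))"
    if N: "1 \<le> N" for N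
  proof (rule emeasure_M_cong)
    fix x assume "x \<in> cf_set I"
    then have x: "x \<in> unit_irrationals" using cf_set_subset by blast
    then have x0: "0 < x" "x \<notin> \<rat>" by (auto simp: unit_irrationals_def)
    have "0 \<le> \<lfloor>1 / x\<rfloor>" using one_le_floor_inverse[OF x] by linarith
    then have "N \<le> digit 0 x \<longleftrightarrow> int N \<le> \<lfloor>1 / x\<rfloor>"
      unfolding digit_def funpow_0 by (rule le_nat_iff)
    also have "\<dots> \<longleftrightarrow> real N \<le> 1 / x" by (simp add: le_floor_iff)
    also have "\<dots> \<longleftrightarrow> x \<le> 1 / real N" using x0 N by (simp add: field_simps)
    also have "\<dots> \<longleftrightarrow> x < 1 / real N"
    proof -
      have "1 / real N \<in> \<rat>" by (intro Rats_divide) auto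
      then have "x \<noteq> 1 / real N" using x0 by metis
      then show ?thesis by linarith
    qed
    finally show "x \<in> {x \<in> unit_irrationals. N \<le> digit 0 x} \<longleftrightarrow> x \<in> ball 0 (1 / real N)"
      using x x0 by simp
  qed auto
  obtain C1 C2 where C: "0 < C1" "0 < C2"
    "\<And>r. 0 < r \<Longrightarrow> r \<le> 1 \<Longrightarrow> ennreal (C1 * r powr h) \<le> emeasure M (ball 0 r)"
    "\<And>r. 0 < r \<Longrightarrow> r \<le> 1 \<Longrightarrow> emeasure M (ball 0 r) \<le> ennreal (C2 * r powr h)"
    using ball_zero_bounds by metis
  have pw: "(1 / real N) powr h = real N powr - h" if "1 \<le> N" for N
    using that by (simp add: powr_divide powr_minus inverse_eq_divide)
  have "C1 * real N powr - h \<le> measure M {x \<in> unit_irrationals. N \<le> digit 0 x}"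
    "measure M {x \<in> unit_irrationals. N \<le> digit 0 x} \<le> C2 * real N powr - h" if N: "1 \<le> N" for N
    using C(3)[of "1 / real N"] C(4)[of "1 / real N"] N C(1,2)
    unfolding measure_def eq[OF N] pw[OF N] by (simp_all add: emeasure_eq_measure)
  then show ?thesis using that C(1,2) by blast
qed

lemma later_digit_eq:
  "{x \<in> unit_irrationals. W (digits n x) \<and> N \<le> digit n x}
    = digit_event n W {x \<in> unit_irrationals. N \<le> digit 0 x}"
  using gauss_iterate_in[of _ n] by (auto simp: digit_event_def digit_gauss)

lemma large_digit_prob:
  obtains C where "0 < C"
    "\<And>n N. 1 \<le> N \<Longrightarrow> measure M {x \<in> unit_irrationals. N \<le> digit n x} \<le> C * real N powr - h"
proof -
  obtain C2 where C2: "0 < C2"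
    "\<And>N. 1 \<le> N \<Longrightarrow> measure M {x \<in> unit_irrationals. N \<le> digit 0 x} \<le> C2 * real N powr - h"
    using large_digit_bounds by metis
  have "measure M {x \<in> unit_irrationals. N \<le> digit n x} \<le> (4 powr h * C2) * real N powr - h"
    if N: "1 \<le> N" for n N
  proof -
    let ?A = "{x \<in> unit_irrationals. N \<le> digit 0 x}"
    have "measure M (digit_event n (\<lambda>_. True) ?A) * mass
        \<le> 4 powr h * (measure M (digit_event n (\<lambda>_. True) UNIV) * measure M ?A)"
      by (rule digit_event_bounds) simp
    also have "\<dots> \<le> 4 powr h * (mass * (C2 * real N powr - h))"
      unfolding mass_def using N C2 by (intro mult_left_mono mult_mono finite_measure_mono) auto
    finally have "measure M (digit_event n (\<lambda>_. True) ?A) \<le> 4 powr h * (C2 * real N powr - h)"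
      using mass_pos by (simp add: mult.left_commute[of _ mass] mult.commute[of _ mass])
    then show ?thesis using later_digit_eq[of "\<lambda>_. True" n N] by (simp add: mult.assoc)
  qed
  then show ?thesis using that[of "4 powr h * C2"] C2 by simp
qed

section \<open>Borel-Cantelli statements for the digits\<close>

lemma digits_eventually_small:
  assumes N: "\<And>n. 1 \<le> N n" and sum: "summable (\<lambda>n. real (N n) powr - h)"
  shows "AE x in M. eventually (\<lambda>n. digit n x < N n) sequentially"
proof -
  obtain C where C: "0 < C"
    "\<And>n N. 1 \<le> N \<Longrightarrow> measure M {x \<in> unit_irrationals. N \<le> digit n x} \<le> C * real N powr - h"
    using large_digit_prob by metis
  have "AE x in M. eventually (\<lambda>n. x \<in> space M - {x \<in> unit_irrationals. N n \<le> digit n x}) sequentially"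
  proof (rule borel_cantelli_AE1)
    show "summable (\<lambda>n. measure M {x \<in> unit_irrationals. N n \<le> digit n x})"
      using C(2)[OF N] by (intro summable_comparison_test'[OF summable_mult[OF sum, of C]]) auto
  qed (auto simp: emeasure_eq_measure)
  then show ?thesis using AE_unit_irrationals
  proof eventually_elim
    case (elim x)
    show ?case using elim(1) by eventually_elim (use elim(2) in auto)
  qed
qed

text \<open>The digits are not independent, so a survival estimate replaces the second
  Borel-Cantelli lemma: whatever is imposed on the earlier digits, the \<open>n\<close>-th reaches
  \<open>N n\<close> with conditional probability at least \<open>t n\<close>. Never doing so from
  index \<open>m\<close> on has mass at most a constant times \<open>exp\<close> of minus a
  divergent sum.\<close>

lemma digits_infinitely_often_large:
  assumes N: "\<And>n. 1 \<le> N n" and div: "\<not> summable (\<lambda>n. real (N n) powr - h)"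
  shows "AE x in M. \<forall>m. \<exists>n\<ge>m. N n \<le> digit n x"
proof -
  obtain C1 where C1: "0 < C1"
    "\<And>N. 1 \<le> N \<Longrightarrow> C1 * real N powr - h \<le> measure M {x \<in> unit_irrationals. N \<le> digit 0 x}"
    using large_digit_bounds by metis
  \<comment> \<open>\<open>C1\<close> is the lower tail bound for the first digit;
    \<open>4 powr h * mass\<close> is the loss in passing to a later digit by
    \<open>digit_event_bounds\<close>.\<close>
  define c where "c = C1 / (4 powr h * mass)"
  have c: "0 < c" using C1 mass_pos by (simp add: c_def)
  define t where "t n = c * real (N n) powr - h" for n
  define W where "W m w \<longleftrightarrow> (\<forall>j. m \<le> j \<and> j < length w \<longrightarrow> w ! j < N j)" for m and w :: "nat list"
  define R where "R m n = digit_event n (W m) UNIV" for m n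
  have R_eq: "R m n = {x \<in> unit_irrationals. \<forall>j. m \<le> j \<and> j < n \<longrightarrow> digit j x < N j}" for m n
    by (auto simp: R_def digit_event_def W_def digits_def)
  have R_meas[measurable]: "R m n \<in> sets borel" for m n by (simp add: R_def)
  have step: "measure M (R m (Suc n)) \<le> exp (- t n) * measure M (R m n)" if "m \<le> n" for m n
  proof -
    let ?A = "{x \<in> unit_irrationals. N n \<le> digit 0 x}"
    have "measure M (R m n) * (C1 * real (N n) powr - h) \<le> measure M (R m n) * measure M ?A"
      using C1(2)[OF N] by (intro mult_left_mono) auto
    also have "\<dots> \<le> 4 powr h * (measure M (digit_event n (W m) ?A) * mass)"
      unfolding R_def by (rule digit_event_bounds) simp
    finally have ge: "t n * measure M (R m n) \<le> measure M (digit_event n (W m) ?A)"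
      using mass_pos by (simp add: t_def c_def field_simps)
    have "R m (Suc n) = R m n - digit_event n (W m) ?A"
      unfolding later_digit_eq[symmetric] R_eq using that
      by (auto simp: W_def digits_def less_Suc_eq not_le)
    moreover have "digit_event n (W m) ?A \<subseteq> R m n" by (auto simp: R_def digit_event_def)
    ultimately have "measure M (R m (Suc n)) = measure M (R m n) - measure M (digit_event n (W m) ?A)"
      by (simp add: finite_measure_Diff)
    also have "\<dots> \<le> (1 - t n) * measure M (R m n)" using ge by (simp add: algebra_simps)
    also have "\<dots> \<le> exp (- t n) * measure M (R m n)"
      using exp_ge_add_one_self[of "- t n"] by (intro mult_right_mono) auto
    finally show ?thesis .
  qed
  have bound: "measure M (R m (m + k)) \<le> exp (- (\<Sum>j<k. t (m + j))) * mass" for m k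
  proof (induction k)
    case 0
    show ?case unfolding mass_def by (auto intro!: finite_measure_mono)
  next
    case (Suc k)
    have "measure M (R m (m + Suc k)) \<le> exp (- t (m + k)) * measure M (R m (m + k))"
      using step[of m "m + k"] by simp
    also have "\<dots> \<le> exp (- t (m + k)) * (exp (- (\<Sum>j<k. t (m + j))) * mass)"
      using Suc by (intro mult_left_mono) auto
    finally show ?case by (simp add: exp_add[symmetric] mult.assoc[symmetric] exp_minus_inverse algebra_simps)
  qed
  have null: "measure M (\<Inter>n. R m n) = 0" for m
  proof -
    define \<epsilon> where "\<epsilon> = measure M (\<Inter>n. R m n)"
    have le: "\<epsilon> \<le> exp (- (\<Sum>j<k. t (m + j))) * mass" for k
      unfolding \<epsilon>_def by (rule order_trans[OF finite_measure_mono bound]) auto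
    have "\<not> 0 < \<epsilon>"
    proof
      assume \<epsilon>: "0 < \<epsilon>"
      \<comment> \<open>A positive surviving mass would bound the partial sums of \<open>t\<close>
        by a logarithm and make the series converge.\<close>
      have "(\<Sum>j<k. t (m + j)) \<le> ln (mass / \<epsilon>)" for k
      proof -
        have "exp (\<Sum>j<k. t (m + j)) \<le> mass / \<epsilon>"
          using le[of k] \<epsilon> by (simp add: exp_minus field_simps)
        then show ?thesis using \<epsilon> mass_pos by (simp add: ln_ge_iff)
      qed
      then have "summable (\<lambda>j. t (m + j))"
        using c by (intro summableI_nonneg_bounded) (auto simp: t_def)
      then have "summable (\<lambda>j. t (j + m))" by (simp add: add.commute)
      then have "summable t" by (simp only: summable_iff_shift)
      then show False using div c unfolding t_def by (subst (asm) summable_cmult_iff) auto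
    qed
    moreover have "0 \<le> \<epsilon>" by (simp add: \<epsilon>_def)
    ultimately show ?thesis unfolding \<epsilon>_def by linarith
  qed
  have "AE x in M. x \<notin> (\<Inter>n. R m n)" for m
    using null[of m] by (intro AE_not_in) (auto simp: null_sets_def emeasure_eq_measure)
  then have "AE x in M. \<forall>m. x \<notin> (\<Inter>n. R m n)" by (simp add: AE_all_countable)
  then show ?thesis using AE_unit_irrationals
    by eventually_elim (force simp: R_eq not_less)
qed

section \<open>Exponential growth of the denominators\<close>

text \<open>Quasi-independence passes from sets to functions: the image under \<open>gauss\<close>
  of \<open>M\<close> restricted to first digit \<open>i\<close> is a measure dominated by a
  multiple of \<open>M\<close>.\<close>

lemma nn_integral_first_digit:
  assumes F [measurable]: "F \<in> borel_measurable borel"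
  shows "(\<integral>\<^sup>+x. indicator {x \<in> unit_irrationals. digit 0 x = i} x * F (gauss x) \<partial>M)
    \<le> ennreal (4 powr h / mass) * emeasure M {x \<in> unit_irrationals. digit 0 x = i} * (\<integral>\<^sup>+x. F x \<partial>M)"
proof -
  define D where "D = {x \<in> unit_irrationals. digit 0 x = i}"
  have D [measurable]: "D \<in> sets borel" by (simp add: D_def)
  define \<nu> where "\<nu> = distr (density M (indicator D)) borel gauss"
  define c where "c = ennreal (4 powr h / mass) * emeasure M D"
  have "\<nu> \<le> scale_measure c M"
  proof (subst le_measure)
    show "sets \<nu> = sets (scale_measure c M)" by (simp add: \<nu>_def)
    show "\<forall>A\<in>sets \<nu>. emeasure \<nu> A \<le> emeasure (scale_measure c M) A"
    proof
      fix A assume "A \<in> sets \<nu>"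
      then have A [measurable]: "A \<in> sets borel" by (simp add: \<nu>_def)
      have [measurable]: "gauss -` A \<in> sets borel" using measurable_sets[OF gauss_measurable A] by simp
      have ev: "D \<inter> gauss -` B = digit_event 1 (\<lambda>w. w = [i]) B" for B
        by (auto simp: D_def digit_event_def digits_def)
      have "emeasure \<nu> A = emeasure (density M (indicator D)) (gauss -` A)"
        unfolding \<nu>_def by (subst emeasure_distr) auto
      also have "\<dots> = emeasure M (D \<inter> gauss -` A)"
        by (subst emeasure_density) (auto simp: indicator_inter_arith[symmetric])
      also have "\<dots> = ennreal (measure M (digit_event 1 (\<lambda>w. w = [i]) A))"
        by (simp add: ev emeasure_eq_measure)
      also have "\<dots> \<le> ennreal (4 powr h / mass * (measure M D * measure M A))"
        using digit_event_bounds(1)[OF A, of 1 "\<lambda>w. w = [i]"] mass_pos ev[of UNIV]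
        by (intro ennreal_leI) (simp add: field_simps)
      also have "\<dots> = emeasure (scale_measure c M) A"
        using mass_pos by (simp add: c_def emeasure_eq_measure ennreal_mult[symmetric] mult.assoc)
      finally show "emeasure \<nu> A \<le> emeasure (scale_measure c M) A" .
    qed
  qed
  then have "(\<integral>\<^sup>+x. F x \<partial>\<nu>) \<le> (\<integral>\<^sup>+x. F x \<partial>scale_measure c M)"
    by (intro nn_integral_mono_measure) (simp_all add: \<nu>_def)
  moreover have "(\<integral>\<^sup>+x. F x \<partial>\<nu>) = (\<integral>\<^sup>+x. indicator D x * F (gauss x) \<partial>M)"
    unfolding \<nu>_def by (simp add: nn_integral_distr nn_integral_density)
  moreover have "(\<integral>\<^sup>+x. F x \<partial>scale_measure c M) = c * (\<integral>\<^sup>+x. F x \<partial>M)"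
    by (rule nn_integral_scale_measure) simp
  ultimately show ?thesis by (simp add: c_def D_def)
qed

lemma suminf_indicator_digit:
  assumes "x \<in> unit_irrationals"
  shows "(\<Sum>i. indicator {x \<in> unit_irrationals. digit 0 x = i} x * (f i :: ennreal)) = f (digit 0 x)"
proof -
  have "(\<Sum>i. indicator {x \<in> unit_irrationals. digit 0 x = i} x * f i)
      = (\<Sum>i\<in>{digit 0 x}. indicator {x \<in> unit_irrationals. digit 0 x = i} x * f i)"
    by (rule suminf_finite) auto
  then show ?thesis using assms by simp
qed

text \<open>Dyadic decomposition: digits of level \<open>k\<close> have \<open>s\<close>-th power at
  most \<open>c k\<close>, while the mass of \<open>T k\<close> is at most
  \<open>C2 * 2 powr (- (real k * h))\<close>. Since \<open>s < h\<close>, a geometric series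
  dominates.\<close>

lemma first_digit_moment_finite:
  assumes s: "0 < s" "s < h"
  shows "(\<Sum>i. ennreal (real i powr s) * emeasure M {x \<in> unit_irrationals. digit 0 x = i}) < \<infinity>"
proof -
  obtain C2 where C2: "0 < C2"
    "\<And>N. 1 \<le> N \<Longrightarrow> measure M {x \<in> unit_irrationals. N \<le> digit 0 x} \<le> C2 * real N powr - h"
    using large_digit_bounds by metis
  define T where "T k = {x \<in> unit_irrationals. (2::nat) ^ k \<le> digit 0 x}" for k
  have T [measurable]: "T k \<in> sets borel" for k by (simp add: T_def)
  define c where "c k = 2 powr ((real k + 1) * s)" for k :: nat
  have "(\<Sum>i. ennreal (real i powr s) * emeasure M {x \<in> unit_irrationals. digit 0 x = i})
      = (\<Sum>i. \<integral>\<^sup>+x. indicator {x \<in> unit_irrationals. digit 0 x = i} x * ennreal (real i powr s) \<partial>M)"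
    by (subst nn_integral_multc) (auto simp: mult.commute)
  also have "\<dots> = (\<integral>\<^sup>+x. (\<Sum>i. indicator {x \<in> unit_irrationals. digit 0 x = i} x * ennreal (real i powr s)) \<partial>M)"
    by (rule nn_integral_suminf[symmetric]) simp
  also have "\<dots> \<le> (\<integral>\<^sup>+x. (\<Sum>k. ennreal (c k) * indicator (T k) x) \<partial>M)"
  proof (rule nn_integral_mono_AE, use AE_unit_irrationals in eventually_elim)
    fix x assume x: "x \<in> unit_irrationals"
    define d where "d = digit 0 x"
    have d: "1 \<le> d" using digit_pos[OF x] by (simp add: d_def)
    \<comment> \<open>The dyadic level of the digit; this one term of the nonnegative series already
      dominates.\<close>
    define k where "k = floor_log d"
    have k: "2 ^ k \<le> d" "d < 2 * 2 ^ k"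
      using floor_log_exp2_le[of d] floor_log_exp2_gt[of d] d by (auto simp: k_def)
    have "real d \<le> real (2 * 2 ^ k)" using k(2) unfolding of_nat_le_iff by simp
    then have "real d powr s \<le> (2 * 2 ^ k) powr s" using s by (intro powr_mono2) auto
    also have "(2 * 2 ^ k :: real) = 2 powr (real k + 1)" by (simp add: powr_add powr_realpow)
    also have "(2 powr (real k + 1)) powr s = c k" by (simp add: c_def powr_powr)
    finally have "ennreal (real d powr s) \<le> ennreal (c k)" by (rule ennreal_leI)
    also have "\<dots> = (\<Sum>k\<in>{k}. ennreal (c k) * indicator (T k) x)"
      using x k by (simp add: T_def d_def)
    also have "\<dots> \<le> (\<Sum>k. ennreal (c k) * indicator (T k) x)" by (rule sum_le_suminf) auto
    finally show "(\<Sum>i. indicator {x \<in> unit_irrationals. digit 0 x = i} x * ennreal (real i powr s))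
        \<le> (\<Sum>k. ennreal (c k) * indicator (T k) x)"
      using suminf_indicator_digit[OF x, of "\<lambda>i. ennreal (real i powr s)"] by (simp add: d_def)
  qed
  also have "\<dots> = (\<Sum>k. ennreal (c k) * emeasure M (T k))"
    by (subst nn_integral_suminf) (auto simp: nn_integral_cmult_indicator)
  also have "\<dots> \<le> (\<Sum>k. ennreal (2 powr s * C2 * (2 powr (s - h)) ^ k))"
  proof (intro suminf_le allI)
    fix k
    have "c k * measure M (T k) \<le> c k * (C2 * real (2 ^ k) powr - h)"
      unfolding T_def using C2(2)[of "2 ^ k"] by (intro mult_left_mono) (auto simp: c_def)
    also have "real (2 ^ k) powr - h = 2 powr (- (real k * h))"
      by (simp add: powr_powr flip: powr_realpow)
    also have "c k * (C2 * 2 powr (- (real k * h))) = 2 powr s * C2 * (2 powr (s - h)) ^ k"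
      by (simp add: c_def powr_powr algebra_simps flip: powr_realpow powr_add)
    finally show "ennreal (c k) * emeasure M (T k) \<le> ennreal (2 powr s * C2 * (2 powr (s - h)) ^ k)"
      by (simp add: emeasure_eq_measure c_def ennreal_mult[symmetric] ennreal_leI)
  qed auto
  also have "\<dots> < \<infinity>"
  proof -
    have "2 powr (s - h) < (1::real)" using s powr_less_mono[of "s - h" 0 2] by simp
    then have "summable (\<lambda>k. 2 powr s * C2 * (2 powr (s - h)) ^ k)"
      by (intro summable_mult summable_geometric) auto
    then show ?thesis using C2 by (subst suminf_ennreal2) auto
  qed
  finally show ?thesis .
qed

lemma digit_Suc: "digit (Suc n) x = digit n (gauss x)"
  using digit_gauss[of n 1 x] by simp

text \<open>Splitting by the first digit leaves the shorter product at \<open>gauss x\<close>. Each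
  step costs the factor \<open>\<kappa>\<close>, the first-digit moment times
  \<open>4 powr h / mass\<close>.\<close>

lemma digit_product_moments:
  assumes s: "0 < s" "s < h"
  obtains K where "0 < K"
    "\<And>n. (\<integral>\<^sup>+x. (\<Prod>i<n. ennreal (real (digit i x) powr s)) \<partial>M) \<le> ennreal (K ^ n * mass)"
proof -
  define Z where "Z n x = (\<Prod>i<n. ennreal (real (digit i x) powr s))" for n x
  have Z [measurable]: "Z n \<in> borel_measurable borel" for n unfolding Z_def by measurable
  define \<kappa> where "\<kappa> = (\<Sum>i. ennreal (real i powr s) *
    (ennreal (4 powr h / mass) * emeasure M {x \<in> unit_irrationals. digit 0 x = i}))"
  have "\<kappa> = ennreal (4 powr h / mass) *
      (\<Sum>i. ennreal (real i powr s) * emeasure M {x \<in> unit_irrationals. digit 0 x = i})"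
    unfolding \<kappa>_def by (subst ennreal_suminf_cmult[symmetric]) (simp only: mult.left_commute)
  then have "\<kappa> < \<infinity>"
    using first_digit_moment_finite[OF s] by (simp add: ennreal_mult_less_top)
  have step: "(\<integral>\<^sup>+x. Z (Suc n) x \<partial>M) \<le> \<kappa> * (\<integral>\<^sup>+x. Z n x \<partial>M)" for n
  proof -
    have "(\<integral>\<^sup>+x. Z (Suc n) x \<partial>M) = (\<integral>\<^sup>+x. (\<Sum>i. indicator {x \<in> unit_irrationals. digit 0 x = i} x *
        (ennreal (real i powr s) * Z n (gauss x))) \<partial>M)"
    proof (rule nn_integral_cong_AE, use AE_unit_irrationals in eventually_elim)
      fix x assume x: "x \<in> unit_irrationals"
      have "Z (Suc n) x = ennreal (real (digit 0 x) powr s) * Z n (gauss x)"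
        unfolding Z_def by (simp add: prod.lessThan_Suc_shift digit_Suc del: prod.lessThan_Suc)
      then show "Z (Suc n) x = (\<Sum>i. indicator {x \<in> unit_irrationals. digit 0 x = i} x *
          (ennreal (real i powr s) * Z n (gauss x)))"
        using suminf_indicator_digit[OF x, of "\<lambda>i. ennreal (real i powr s) * Z n (gauss x)"] by simp
    qed
    also have "\<dots> = (\<Sum>i. \<integral>\<^sup>+x. indicator {x \<in> unit_irrationals. digit 0 x = i} x *
        (ennreal (real i powr s) * Z n (gauss x)) \<partial>M)"
      by (rule nn_integral_suminf) simp
    also have "\<dots> = (\<Sum>i. ennreal (real i powr s) *
        (\<integral>\<^sup>+x. indicator {x \<in> unit_irrationals. digit 0 x = i} x * Z n (gauss x) \<partial>M))"
      by (subst nn_integral_cmult[symmetric]) (auto simp: mult_ac)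
    also have "\<dots> \<le> (\<Sum>i. ennreal (real i powr s) * (ennreal (4 powr h / mass) *
        emeasure M {x \<in> unit_irrationals. digit 0 x = i} * (\<integral>\<^sup>+x. Z n x \<partial>M)))"
      by (intro suminf_le allI mult_left_mono nn_integral_first_digit) auto
    also have "\<dots> = \<kappa> * (\<integral>\<^sup>+x. Z n x \<partial>M)"
      unfolding \<kappa>_def by (subst ennreal_suminf_multc[symmetric]) (simp add: mult.assoc)
    finally show ?thesis .
  qed
  \<comment> \<open>The added \<open>1\<close> makes \<open>K\<close> positive.\<close>
  define K where "K = enn2real \<kappa> + 1"
  have K: "0 < K" "\<kappa> \<le> ennreal K"
    using \<open>\<kappa> < \<infinity>\<close> by (auto simp: K_def add_nonneg_pos ennreal_plus less_top[symmetric])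
  have "(\<integral>\<^sup>+x. Z n x \<partial>M) \<le> ennreal (K ^ n * mass)" for n
  proof (induction n)
    case 0
    show ?case by (simp add: Z_def mass_def emeasure_eq_measure)
  next
    case (Suc n)
    have "(\<integral>\<^sup>+x. Z (Suc n) x \<partial>M) \<le> ennreal K * ennreal (K ^ n * mass)"
      by (rule order_trans[OF step mult_mono[OF K(2) Suc]]) auto
    then show ?case using K mass_pos by (simp add: ennreal_mult[symmetric] mult.assoc)
  qed
  then show ?thesis using that K(1) unfolding Z_def by blast
qed

text \<open>Markov's inequality for a moment of order \<open>s\<close> makes a digit product above
  \<open>2 ^ (b * n)\<close> exponentially unlikely, so Borel-Cantelli applies; the denominator is
  controlled by this product.\<close>

lemma denominator_growth:
  obtains b where "1 \<le> b"
    "AE x in M. eventually (\<lambda>n. cden (\<lambda>i. digit i x) (Suc n) \<le> 2 ^ (b * n)) sequentially"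
proof -
  define s where "s = h / 2"
  have s: "0 < s" "s < h" using h_pos by (auto simp: s_def)
  obtain K where K: "0 < K"
    "\<And>n. (\<integral>\<^sup>+x. (\<Prod>i<n. ennreal (real (digit i x) powr s)) \<partial>M) \<le> ennreal (K ^ n * mass)"
    using digit_product_moments[OF s] by metis
  \<comment> \<open>Large enough for \<open>2 powr (- (real b * s))\<close> to absorb
    \<open>K\<close> and leave a ratio of at most \<open>1 / 2\<close>.\<close>
  obtain b :: nat where b: "log 2 (2 * K) / s \<le> real b" using real_arch_simple by blast
  have Kb: "2 * K \<le> 2 powr (real b * s)"
    using b s K(1) by (simp add: le_powr_iff field_simps)
  define P where "P n = {x \<in> unit_irrationals. 2 ^ (b * n) \<le> (\<Prod>i<n. real (digit i x))}" for n
  have P [measurable]: "P n \<in> sets borel" for n unfolding P_def by measurable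
  have Pm: "measure M (P n) \<le> mass * (1 / 2) ^ n" for n
  proof -
    define c where "c = 2 powr (- (real (b * n) * s))"
    have "emeasure M (P n) = (\<integral>\<^sup>+x. indicator (P n) x \<partial>M)" by simp
    also have "\<dots> \<le> (\<integral>\<^sup>+x. ennreal c * (\<Prod>i<n. ennreal (real (digit i x) powr s)) \<partial>M)"
    proof (rule nn_integral_mono)
      fix x
      show "indicator (P n) x \<le> ennreal c * (\<Prod>i<n. ennreal (real (digit i x) powr s))"
      proof (cases "x \<in> P n")
        case True
        then have "2 powr (real (b * n)) \<le> (\<Prod>i<n. real (digit i x))"
          by (simp add: P_def powr_realpow del: of_nat_mult)
        then have "(2 powr (real (b * n))) powr s \<le> (\<Prod>i<n. real (digit i x)) powr s"
          using s by (intro powr_mono2) auto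
        also have "\<dots> = (\<Prod>i<n. real (digit i x) powr s)" by (rule prod_powr_distrib)
        finally have "c * 2 powr (real (b * n) * s) \<le> c * (\<Prod>i<n. real (digit i x) powr s)"
          by (intro mult_left_mono) (auto simp: powr_powr c_def)
        moreover have "c * 2 powr (real (b * n) * s) = 1" by (simp add: c_def flip: powr_add)
        ultimately have "ennreal 1 \<le> ennreal (c * (\<Prod>i<n. real (digit i x) powr s))"
          by (intro ennreal_leI) simp
        also have "\<dots> = ennreal c * (\<Prod>i<n. ennreal (real (digit i x) powr s))"
          by (simp add: ennreal_mult prod_ennreal prod_nonneg c_def)
        finally show ?thesis using True by simp
      qed simp
    qed
    also have "\<dots> = ennreal c * (\<integral>\<^sup>+x. (\<Prod>i<n. ennreal (real (digit i x) powr s)) \<partial>M)"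
      by (rule nn_integral_cmult) simp
    also have "\<dots> \<le> ennreal c * ennreal (K ^ n * mass)" by (intro mult_left_mono K) simp
    also have "\<dots> = ennreal (c * (K ^ n * mass))"
      using K(1) mass_pos by (intro ennreal_mult[symmetric]) (auto simp: c_def)
    finally have "measure M (P n) \<le> c * (K ^ n * mass)"
      using K(1) mass_pos by (simp add: emeasure_eq_measure c_def)
    also have "\<dots> = mass * (2 powr (- (real b * s)) * K) ^ n"
      by (simp add: c_def power_mult_distrib powr_powr algebra_simps flip: powr_realpow)
    also have "\<dots> \<le> mass * (1 / 2) ^ n"
    proof -
      have "2 powr (- (real b * s)) * K \<le> 1 / 2" using Kb by (simp add: powr_minus field_simps)
      then show ?thesis using K(1) mass_pos by (intro mult_left_mono power_mono) auto
    qed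
    finally show ?thesis .
  qed
  have "AE x in M. eventually (\<lambda>n. x \<in> space M - P n) sequentially"
  proof (rule borel_cantelli_AE1)
    have "summable (\<lambda>n. mass * (1 / 2) ^ n)" by (intro summable_mult summable_geometric) simp
    then show "summable (\<lambda>n. measure M (P n))"
      by (rule summable_comparison_test') (use Pm in auto)
  qed (auto simp: emeasure_eq_measure)
  \<comment> \<open>The exponent grows by \<open>1\<close> per digit because
    \<open>digit i x + 1\<close> is replaced by \<open>2 * digit i x\<close>.\<close>
  then have "AE x in M. eventually (\<lambda>n. cden (\<lambda>i. digit i x) (Suc n) \<le> 2 ^ ((b + 1) * n)) sequentially"
    using AE_unit_irrationals
  proof eventually_elim
    case (elim x)
    note x = elim(2)
    show ?case using elim(1)
    proof eventually_elim
      case (elim n)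
      then have "real (\<Prod>i<n. digit i x) < real (2 ^ (b * n))" using x by (simp add: P_def not_le)
      then have lt: "(\<Prod>i<n. digit i x) < 2 ^ (b * n)" by (simp only: of_nat_less_iff)
      have "cden (\<lambda>i. digit i x) (Suc n) \<le> (\<Prod>i<n. digit i x + 1)"
        using digit_pos[OF x] by (rule cden_le_prod)
      also have "\<dots> \<le> (\<Prod>i<n. 2 * digit i x)"
        using digit_pos[OF x] by (intro prod_mono) (auto simp: Suc_le_eq)
      also have "\<dots> = 2 ^ n * (\<Prod>i<n. digit i x)" by (simp add: prod.distrib)
      also have "\<dots> \<le> 2 ^ n * 2 ^ (b * n)" using lt by (intro mult_le_mono2) simp
      also have "\<dots> = 2 ^ ((b + 1) * n)" by (simp add: power_add)
      finally show ?case .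
    qed
  qed
  then show ?thesis using that[of "b + 1"] by simp
qed

end

section \<open>Khinchin's theorem\<close>

text \<open>Each term is repeated \<open>k\<close> times. This undoes the thinning of exponents when
  growth rates of denominators are compared with powers of two.\<close>

lemma summable_div:
  fixes g :: "nat \<Rightarrow> real"
  assumes g: "summable g" "\<And>n. 0 \<le> g n" and k: "1 \<le> k"
  shows "summable (\<lambda>n. g (n div k))"
proof (rule summableI_nonneg_bounded)
  fix N
  have "(\<Sum>n<N. g (n div k)) \<le> (\<Sum>n<N * k. g (n div k))"
    using g k by (intro sum_mono2) (auto intro: order.strict_trans2)
  also have "\<dots> = (\<Sum>m<N. \<Sum>n\<in>{m * k..<m * k + k}. g (n div k))"
    by (rule sum.nat_group[symmetric])
  also have "\<dots> = (\<Sum>m<N. real k * g m)"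
  proof (rule sum.cong)
    fix m
    have "n div k = m" if "n \<in> {m * k..<m * k + k}" for n
      using that by (intro div_nat_eqI) (auto simp: algebra_simps)
    then show "(\<Sum>n\<in>{m * k..<m * k + k}. g (n div k)) = real k * g m" by simp
  qed simp
  also have "\<dots> \<le> real k * suminf g"
    unfolding sum_distrib_left[symmetric] using g by (intro mult_left_mono sum_le_suminf) auto
  finally show "(\<Sum>n<N. g (n div k)) \<le> real k * suminf g" .
qed (use g in auto)

text \<open>The term at \<open>q\<close> is \<open>f q powr h / real q\<close>, which is
  nonincreasing. In Cauchy condensation the weight \<open>2 ^ n\<close> cancels the
  denominator.\<close>

lemma summable_condensed:
  fixes \<psi> :: "nat \<Rightarrow> real"
  assumes h: "0 < h" and \<psi>_pos: "\<And>q. 1 \<le> q \<Longrightarrow> 0 < \<psi> q"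
    and mono: "antimono_on {1..} (\<lambda>q. (real q)\<^sup>2 * \<psi> q)"
  shows "summable (\<lambda>n. real (Suc n) powr (2 * h - 1) * \<psi> (Suc n) powr h)
     \<longleftrightarrow> summable (\<lambda>n. ((real (2 ^ n))\<^sup>2 * \<psi> (2 ^ n)) powr h)"
proof -
  define f where "f q = (real q)\<^sup>2 * \<psi> q" for q :: nat
  define a where "a q = f q powr h / real q" for q
  have "real (Suc n) powr (2 * h - 1) * \<psi> (Suc n) powr h = a (Suc n)" for n
    using \<psi>_pos[of "Suc n"]
    by (simp add: a_def f_def powr_mult powr_diff powr_powr flip: powr_numeral del: of_nat_Suc)
  then have "summable (\<lambda>n. real (Suc n) powr (2 * h - 1) * \<psi> (Suc n) powr h) \<longleftrightarrow> summable a"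
    by (simp add: summable_Suc_iff)
  also have "\<dots> \<longleftrightarrow> summable (\<lambda>n. 2 ^ n * a (2 ^ n))"
  proof (rule condensation_test)
    fix m :: nat assume m: "0 < m"
    have "f (Suc m) \<le> f m" using monotone_onD[OF mono, of m "Suc m"] m by (simp add: f_def del: of_nat_Suc)
    moreover have "0 \<le> f (Suc m)" using \<psi>_pos[of "Suc m"] by (simp add: f_def)
    ultimately show "a (Suc m) \<le> a m"
      unfolding a_def using m h by (intro frac_le powr_mono2) auto
  qed (simp add: a_def)
  also have "(\<lambda>n. 2 ^ n * a (2 ^ n)) = (\<lambda>n. f (2 ^ n) powr h)" by (simp add: a_def)
  finally show ?thesis by (simp add: f_def)
qed

section \<open>The convergent and the divergent case\<close>

context regular_cf_set
begin

text \<open>For large denominators Legendre's theorem leaves only convergents. If the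
  \<open>n\<close>-th one, of denominator \<open>q\<close>, is within \<open>\<psi> q\<close>, then
  \<open>digit n x + 2\<close> is at least \<open>1 / f q\<close>. As
  \<open>q \<ge> 2 ^ (n div 2)\<close>, this is at least \<open>t n\<close>, which almost surely
  happens only finitely often.\<close>

lemma khinchin_convergent:
  assumes \<psi>_pos: "\<And>q. 1 \<le> q \<Longrightarrow> 0 < \<psi> q"
    and mono: "antimono_on {1..} (\<lambda>q. (real q)\<^sup>2 * \<psi> q)"
    and sum: "summable (\<lambda>n. ((real (2 ^ n))\<^sup>2 * \<psi> (2 ^ n)) powr h)"
  shows "AE x in M. \<not> psi_approximable \<psi> x"
proof -
  define f where "f q = (real q)\<^sup>2 * \<psi> q" for q :: nat
  have f_pos: "0 < f q" if "1 \<le> q" for q using \<psi>_pos[OF that] that by (simp add: f_def)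
  have f_mono: "f q' \<le> f q" if "1 \<le> q" "q \<le> q'" for q q'
    using mono that by (auto simp: monotone_on_def f_def)
  have \<psi>_f: "\<psi> q = f q / (real q)\<^sup>2" if "1 \<le> q" for q using that by (simp add: f_def)
  have sum_f: "summable (\<lambda>n. f (2 ^ n) powr h)" using sum by (simp add: f_def)
  \<comment> \<open>From \<open>q0\<close> on, \<open>\<psi> q\<close> is below Legendre's threshold
    \<open>1 / (2 * (real q)\<^sup>2)\<close>.\<close>
  obtain q0 where q0: "\<And>q. q0 \<le> q \<Longrightarrow> f q < 1 / 2" "1 \<le> q0"
  proof -
    have "eventually (\<lambda>n. f (2 ^ n) powr h < (1 / 2) powr h) sequentially"
      using order_tendstoD(2)[OF summable_LIMSEQ_zero[OF sum_f], of "(1 / 2) powr h"] by simp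
    then obtain n where n: "f (2 ^ n) powr h < (1 / 2) powr h" by (auto simp: eventually_sequentially)
    have "f (2 ^ n) < 1 / 2" by (rule powr_less_cancel2[OF h_pos _ _ n]) (use f_pos in auto)
    then have "f q < 1 / 2" if "2 ^ n \<le> q" for q using f_mono[of "2 ^ n" q] that by simp
    then show ?thesis using that[of "2 ^ n"] by simp
  qed
  define t where "t n = 1 / f (2 ^ (n div 2))" for n
  have t: "0 < t n" for n using f_pos by (simp add: t_def)
  \<comment> \<open>Subtracting \<open>2\<close> compensates the \<open>+ 2\<close> in
    \<open>convergent_error\<close>; \<open>max 1\<close> keeps the threshold positive, also when
    the natural subtraction truncates.\<close>
  define N where "N n = max 1 (nat \<lceil>t n\<rceil> - 2)" for n
  have "AE x in M. eventually (\<lambda>n. digit n x < N n) sequentially"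
  proof (rule digits_eventually_small)
    have "summable (\<lambda>n. 3 powr h * f (2 ^ (n div 2)) powr h)"
      using summable_div[OF sum_f, of 2] by (intro summable_mult) simp
    then show "summable (\<lambda>n. real (N n) powr - h)"
    proof (rule summable_comparison_test')
      fix n
      have "t n \<le> real (nat \<lceil>t n\<rceil>)" by linarith
      \<comment> \<open>For \<open>t n \<le> 3\<close> the value \<open>1\<close> suffices; beyond
        that, \<open>t n - 2\<close> is at least \<open>t n / 3\<close>.\<close>
      then have "t n / 3 \<le> real (N n)" unfolding N_def by linarith
      then have "real (N n) powr - h \<le> (t n / 3) powr - h"
        using t[of n] h_pos by (intro powr_mono2') auto
      also have "\<dots> = 3 powr h * f (2 ^ (n div 2)) powr h"
        using f_pos[of "2 ^ (n div 2)"] by (simp add: t_def powr_minus powr_divide powr_mult field_simps)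
      finally show "norm (real (N n) powr - h) \<le> 3 powr h * f (2 ^ (n div 2)) powr h" by simp
    qed
  qed (simp add: N_def)
  then show ?thesis using AE_unit_irrationals
  proof eventually_elim
    case (elim x)
    note x = elim(2)
    define \<omega> where "\<omega> = (\<lambda>i. digit i x)"
    obtain m where m: "\<And>n. m \<le> n \<Longrightarrow> digit n x < N n"
      using elim(1) by (auto simp: eventually_sequentially)
    define S where "S = {(p::int, q::nat). 1 \<le> q \<and> coprime p (int q) \<and> \<bar>x - of_int p / real q\<bar> \<le> \<psi> q}"
    \<comment> \<open>For \<open>q < q0\<close>, the bounds \<open>x < 1\<close> and
      \<open>\<psi> q \<le> f 1\<close> confine the numerator. Besides this box, \<open>T\<close>
      holds only the convergents of index below \<open>m\<close>.\<close>
    define B where "B = \<lceil>real q0 * (1 + f 1)\<rceil>"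
    define T where "T = ({- B..B} \<times> {..<q0}) \<union> (\<lambda>n. (int (cnum \<omega> (Suc n)), cden \<omega> (Suc n))) ` {..<m}"
    have "S \<subseteq> T"
    proof
      fix z assume "z \<in> S"
      then obtain p q where z: "z = (p, q)" and q: "1 \<le> q" and pq: "coprime p (int q)"
        and close: "\<bar>x - of_int p / real q\<bar> \<le> \<psi> q" by (auto simp: S_def)
      show "z \<in> T"
      proof (cases "q < q0")
        case True
        have "\<psi> q \<le> f 1"
        proof -
          have "1 \<le> (real q)\<^sup>2" using q by simp
          then have "f q / (real q)\<^sup>2 \<le> f q / 1" using f_pos[OF q] q by (intro divide_left_mono) auto
          then show ?thesis using f_mono[of 1 q] q by (simp add: \<psi>_f)
        qed
        then have "\<bar>of_int p / real q\<bar> \<le> 1 + f 1"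
          using close x by (auto simp: unit_irrationals_def)
        then have "\<bar>of_int p\<bar> \<le> real q * (1 + f 1)" using q by (simp add: field_simps)
        also have "\<dots> \<le> real q0 * (1 + f 1)" using True f_pos[of 1] by (intro mult_right_mono) auto
        also have "\<dots> \<le> of_int B" unfolding B_def by (rule le_of_int_ceiling)
        finally have "\<bar>p\<bar> \<le> B" by (simp only: of_int_le_iff flip: of_int_abs)
        then show ?thesis using True z by (auto simp: T_def)
      next
        case False
        have "\<psi> q < 1 / (2 * (real q)\<^sup>2)"
          using q0(1)[of q] False q by (simp add: \<psi>_f field_simps)
        then obtain n where n: "p = int (cnum \<omega> (Suc n))" "q = cden \<omega> (Suc n)"
          using legendre[OF x q pq] close unfolding \<omega>_def by fastforce
        have "n < m"
        proof (rule ccontr)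
          assume "\<not> n < m"
          then have "digit n x < N n" using m by simp
          moreover have "1 \<le> digit n x" using digit_pos[OF x] .
          ultimately have "digit n x + 2 < nat \<lceil>t n\<rceil>" unfolding N_def by linarith
          then have less: "real (digit n x) + 2 < t n" by linarith
          have "1 / ((real q)\<^sup>2 * (real (digit n x) + 2)) \<le> \<psi> q"
            using convergent_error(2)[OF x, of n] close unfolding n \<omega>_def by simp
          also have "\<dots> \<le> f (2 ^ (n div 2)) / (real q)\<^sup>2"
            unfolding \<psi>_f[OF q] using cden_ge_power[of \<omega> n] digit_pos[OF x] n(2)
            by (intro divide_right_mono f_mono) (auto simp: \<omega>_def simp del: cden.simps)
          finally have "1 / (real (digit n x) + 2) / (real q)\<^sup>2 \<le> f (2 ^ (n div 2)) / (real q)\<^sup>2"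
            by (simp add: mult.commute)
          then have "1 / (real (digit n x) + 2) \<le> f (2 ^ (n div 2))"
            using q unfolding divide_le_cancel by simp
          then have "t n \<le> real (digit n x) + 2"
            using f_pos[of "2 ^ (n div 2)"] by (simp add: t_def field_simps)
          then show False using less by simp
        qed
        then show ?thesis using z n by (auto simp: T_def simp del: cden.simps cnum.simps)
      qed
    qed
    moreover have "finite T" by (simp add: T_def)
    ultimately have "finite S" by (rule finite_subset)
    then show ?case by (simp add: psi_approximable_def S_def)
  qed
qed

text \<open>Almost surely the denominators are eventually at most \<open>2 ^ (b * n)\<close>. By
  monotonicity of \<open>f\<close>, a digit of at least \<open>1 / f (2 ^ (b * n))\<close> then
  brings the \<open>n\<close>-th convergent within \<open>\<psi>\<close> of its denominator.\<close>

lemma khinchin_divergent: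
  assumes \<psi>_pos: "\<And>q. 1 \<le> q \<Longrightarrow> 0 < \<psi> q"
    and mono: "antimono_on {1..} (\<lambda>q. (real q)\<^sup>2 * \<psi> q)"
    and div: "\<not> summable (\<lambda>n. ((real (2 ^ n))\<^sup>2 * \<psi> (2 ^ n)) powr h)"
  shows "AE x in M. psi_approximable \<psi> x"
proof -
  define f where "f q = (real q)\<^sup>2 * \<psi> q" for q :: nat
  have f_pos: "0 < f q" if "1 \<le> q" for q using \<psi>_pos[OF that] that by (simp add: f_def)
  have f_mono: "f q' \<le> f q" if "1 \<le> q" "q \<le> q'" for q q'
    using mono that by (auto simp: monotone_on_def f_def)
  have \<psi>_f: "\<psi> q = f q / (real q)\<^sup>2" if "1 \<le> q" for q using that by (simp add: f_def)
  obtain b where b: "1 \<le> b"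
    "AE x in M. eventually (\<lambda>n. cden (\<lambda>i. digit i x) (Suc n) \<le> 2 ^ (b * n)) sequentially"
    using denominator_growth .
  define t where "t n = 1 / f (2 ^ (b * n))" for n
  have t: "0 < t n" for n using f_pos by (simp add: t_def)
  define N where "N n = nat \<lceil>t n\<rceil>" for n
  have N: "1 \<le> N n" "t n \<le> real (N n)" "real (N n) < t n + 1" for n
    using t[of n] unfolding N_def by linarith+
  have "\<not> summable (\<lambda>n. real (N n) powr - h)"
  proof
    assume sN: "summable (\<lambda>n. real (N n) powr - h)"
    \<comment> \<open>Terms below \<open>1\<close> mean \<open>N n \<ge> 2\<close>, hence
      \<open>t n > 1\<close>, and rounding up costs at most a factor \<open>2\<close>.\<close>
    have "eventually (\<lambda>n. real (N n) powr - h < 1) sequentially"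
      using order_tendstoD(2)[OF summable_LIMSEQ_zero[OF sN]] by simp
    then have "eventually (\<lambda>n. norm (f (2 ^ (b * n)) powr h) \<le> 2 powr h * real (N n) powr - h) sequentially"
    proof eventually_elim
      case (elim n)
      then have "N n \<noteq> 1" by auto
      then have "real (N n) \<le> 2 * t n" using N[of n] by linarith
      then have "(2 * t n) powr - h \<le> real (N n) powr - h"
        using N(1)[of n] h_pos by (intro powr_mono2') auto
      moreover have "f (2 ^ (b * n)) powr h = 2 powr h * (2 * t n) powr - h"
        using f_pos[of "2 ^ (b * n)"] by (simp add: t_def powr_minus powr_divide powr_mult field_simps)
      ultimately show ?case by simp
    qed
    then have "summable (\<lambda>n. f (2 ^ (b * n)) powr h)"
      by (rule summable_comparison_test_ev) (intro summable_mult sN)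
    \<comment> \<open>Each exponent is compared with the largest multiple of \<open>b\<close> not
      above it.\<close>
    then have "summable (\<lambda>n. f (2 ^ (b * (n div b))) powr h)"
      using b(1) summable_div[of "\<lambda>n. f (2 ^ (b * n)) powr h" b] by simp
    then have "summable (\<lambda>n. f (2 ^ n) powr h)"
    proof (rule summable_comparison_test')
      fix n
      have "f (2 ^ n) \<le> f (2 ^ (b * (n div b)))" by (intro f_mono power_increasing) auto
      then show "norm (f (2 ^ n) powr h) \<le> f (2 ^ (b * (n div b))) powr h"
        using f_pos[of "2 ^ n"] h_pos by (auto intro: powr_mono2)
    qed
    then show False using div by (simp add: f_def)
  qed
  with N(1) have "AE x in M. \<forall>m. \<exists>n\<ge>m. N n \<le> digit n x" by (rule digits_infinitely_often_large)
  then show ?thesis using b(2) AE_unit_irrationals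
  proof eventually_elim
    case (elim x)
    note x = elim(3)
    define \<omega> where "\<omega> = (\<lambda>i. digit i x)"
    have pos: "\<And>i. 1 \<le> \<omega> i" using digit_pos[OF x] by (simp add: \<omega>_def)
    obtain m where m: "\<And>n. m \<le> n \<Longrightarrow> cden \<omega> (Suc n) \<le> 2 ^ (b * n)"
      using elim(2) by (auto simp: eventually_sequentially \<omega>_def)
    define S where "S = {(p::int, q::nat). 1 \<le> q \<and> coprime p (int q) \<and> \<bar>x - of_int p / real q\<bar> \<le> \<psi> q}"
    \<comment> \<open>Unbounded denominators show that the good indices yield infinitely many
      fractions; \<open>n \<ge> 2 * k\<close> makes \<open>2 ^ (n div 2)\<close> exceed
      \<open>k\<close>.\<close>
    have "\<exists>q\<in>snd ` S. k < q" for k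
    proof -
      obtain n where n: "max m (2 * k) \<le> n" "N n \<le> digit n x" using elim(1) by blast
      define q where "q = cden \<omega> (Suc n)"
      have q: "1 \<le> q" using cden_pos[of n \<omega>] pos by (simp add: q_def)
      have "t n \<le> real (digit n x)" using N(2)[of n] n(2) by linarith
      then have "1 / real (digit n x) \<le> f (2 ^ (b * n))"
        using t[of n] f_pos[of "2 ^ (b * n)"] digit_pos[OF x, of n] by (simp add: t_def field_simps)
      also have "\<dots> \<le> f q" using q m[of n] n(1) unfolding q_def by (intro f_mono) auto
      finally have "1 / real (digit n x) \<le> f q" .
      then have "1 / real (digit n x) / (real q)\<^sup>2 \<le> \<psi> q"
        unfolding \<psi>_f[OF q] by (rule divide_right_mono) simp
      then have "1 / ((real q)\<^sup>2 * real (digit n x)) \<le> \<psi> q" by (simp add: mult.commute)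
      then have "\<bar>x - real (cnum \<omega> (Suc n)) / real q\<bar> \<le> \<psi> q"
        using convergent_error(1)[OF x, of n] unfolding q_def \<omega>_def by linarith
      then have "(int (cnum \<omega> (Suc n)), q) \<in> S"
        using q cnum_cden_coprime[of \<omega> "Suc n"] by (simp add: S_def q_def)
      moreover have "k < q"
      proof -
        have "k < 2 ^ k" by (rule less_exp)
        also have "\<dots> \<le> 2 ^ (n div 2)" using n(1) by (intro power_increasing) auto
        also have "\<dots> \<le> q" unfolding q_def using pos by (rule cden_ge_power)
        finally show ?thesis .
      qed
      ultimately show ?thesis by force
    qed
    then have "infinite (snd ` S)" unfolding infinite_nat_iff_unbounded by blast
    then have "infinite S" by blast
    then show ?case using x by (simp add: psi_approximable_def S_def unit_irrationals_def)
  qed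
qed

end

theorem theorem6p1:
  fixes I :: "nat set" and h :: real and \<mu> :: "real measure" and \<psi> :: "nat \<Rightarrow> real"
  assumes I_pos: "I \<subseteq> {1..}" and I_inf: "infinite I"
    and h: "h = hausdorff_dim (cf_set I)"
    and \<mu>: "\<mu> = hausdorff_on h (cf_set I)"
    and reg: "ahlfors_regular h \<mu>"
    and \<psi>_pos: "\<And>q. 1 \<le> q \<Longrightarrow> 0 < \<psi> q"
    and \<psi>_mono: "antimono_on {1..} (\<lambda>q. (real q)\<^sup>2 * \<psi> q)"
  shows "(\<not> summable (\<lambda>n. real (Suc n) powr (2 * h - 1) * \<psi> (Suc n) powr h)
            \<longrightarrow> (AE x in \<mu>. psi_approximable \<psi> x)) \<and>
         (summable (\<lambda>n. real (Suc n) powr (2 * h - 1) * \<psi> (Suc n) powr h)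
            \<longrightarrow> (AE x in \<mu>. \<not> psi_approximable \<psi> x))"
proof -
  interpret regular_cf_set I h
    using I_pos I_inf reg unfolding \<mu> by unfold_locales
  have "summable (\<lambda>n. real (Suc n) powr (2 * h - 1) * \<psi> (Suc n) powr h)
      \<longleftrightarrow> summable (\<lambda>n. ((real (2 ^ n))\<^sup>2 * \<psi> (2 ^ n)) powr h)"
    by (rule summable_condensed[OF h_pos \<psi>_pos \<psi>_mono])
  moreover have "AE x in M. \<not> psi_approximable \<psi> x"
    if "summable (\<lambda>n. ((real (2 ^ n))\<^sup>2 * \<psi> (2 ^ n)) powr h)"
    by (rule khinchin_convergent[OF \<psi>_pos \<psi>_mono that])
  moreover have "AE x in M. psi_approximable \<psi> x"
    if "\<not> summable (\<lambda>n. ((real (2 ^ n))\<^sup>2 * \<psi> (2 ^ n)) powr h)"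
    by (rule khinchin_divergent[OF \<psi>_pos \<psi>_mono that])
  ultimately show ?thesis unfolding \<mu> by blast
qed

end
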